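(* Let $L$ be a linear pencil of size $m$ in the variables $X=(X_1,\dots,X_n)$ and let $f\in\mathbb{R}[X]_1$. Then $f\ge0$ on $S_L$ if and only if there exist quadratic sos-matrices $S_1,\dots,S_n\in\mathbb{R}[X]^{m\times m}$, real symmetric matrices $U_1,\dots,U_n\in\mathbb{R}^{s(1)\times s(1)}$, matrices $W_1,\dots,W_n\in\mathbb{R}^{s(2)\times s(1)}$, a real symmetric positive semidefinite matrix $S\in\mathbb{R}^{m\times m}$, and a real number $c\ge0$ such that, with $W_0:=0$, $$\vec{X}_1^{\,*}U_i\vec{X}_1+\vec{X}_2^{\,*}W_{i-1}\vec{X}_1+\operatorname{tr}(LS_i)=0\qquad(i\in\{1,\dots,n\}),$$ $$U_i\succeq W_i^*W_i\qquad(i\in\{1,\dots,n\}),$$ $$f-c+\vec{X}_2^{\,*}W_n\vec{X}_1-\operatorname{tr}(LS)=0.$$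
   Context: $\mathbb{R}[X]=\mathbb{R}[X_1,\dots,X_n]$, and $\mathbb{R}[X]_k$ is the space of polynomials of degree at most $k$. A linear pencil of size $m$ is a symmetric matrix in $\mathbb{R}[X]_1^{m\times m}$, i.e. $L=A_0+\sum_{i=1}^nX_iA_i$ with real symmetric $m\times m$ matrices $A_i$. $A^*$ denotes the transpose; $A\succeq B$ means that $A-B$ is real symmetric positive semidefinite. $S_L=\{x\in\mathbb{R}^n\mid L(x)\succeq0\}$. An sos-matrix is a matrix $S\in\mathbb{R}[X]^{m\times m}$ of the form $S=P^*P$ with $P\in\mathbb{R}[X]^{r\times m}$ for some $r\in\mathbb{N}$; it is quadratic if all its entries have degree at most $2$. For $d\ge0$, $s(d)=\binom{d+n}{n}$ is the number of monomials of degree at most $d$ in $n$ variables, and $\vec{X}_d\in\mathbb{R}[X]^{s(d)}$ is the column vector of all these monomials, ordered first by degree and then lexicographically; in particular $\vec{X}_1=(1,X_1,\dots,X_n)^*$. The displayed equations are identities of polynomials in $\mathbb{R}[X]$. *)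

theory Defs
  imports "HOL-Library.Poly_Mapping" "Jordan_Normal_Form.Matrix"
begin

section \<open>Real polynomials in finitely many variables\<close>

text \<open>
  Power products are finitely supported exponent functions, and polynomials are finitely supported
  coefficient functions on power products. The variables are numbered from 0, so the ring in the
  variables numbered below n consists of the polynomials in which only exponents at
  positions below n occur. Matrices and vectors of polynomials use the ring
  structure of this type.
\<close>

type_synonym monomial = "nat \<Rightarrow>\<^sub>0 nat"
type_synonym rpoly = "monomial \<Rightarrow>\<^sub>0 real"

definition mdeg :: "monomial \<Rightarrow> nat" where
  "mdeg a = (\<Sum>i\<in>Poly_Mapping.keys a. Poly_Mapping.lookup a i)"

definition monomials_in :: "nat \<Rightarrow> monomial set" where
  "monomials_in n = {a. Poly_Mapping.keys a \<subseteq> {..<n}}"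

definition polys_in :: "nat \<Rightarrow> rpoly set" where
  "polys_in n = {p. Poly_Mapping.keys p \<subseteq> monomials_in n}"

definition polys_deg_le :: "nat \<Rightarrow> nat \<Rightarrow> rpoly set" where
  "polys_deg_le n k = {p \<in> polys_in n. \<forall>a\<in>Poly_Mapping.keys p. mdeg a \<le> k}"

definition Const :: "real \<Rightarrow> rpoly" where
  "Const r = Poly_Mapping.single 0 r"

definition poly_eval :: "real vec \<Rightarrow> rpoly \<Rightarrow> real" where
  "poly_eval x p = 
     (\<Sum>a\<in>Poly_Mapping.keys p. Poly_Mapping.lookup p a *
       (\<Prod>i\<in>Poly_Mapping.keys a. vec_index x i ^ Poly_Mapping.lookup a i))"


section \<open>Symmetric, positive semidefinite and sos matrices\<close>

definition sym_mat :: "nat \<Rightarrow> 'a mat \<Rightarrow> bool" where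
  "sym_mat m A \<longleftrightarrow> A \<in> carrier_mat m m \<and> transpose_mat A = A"

definition psd_mat :: "nat \<Rightarrow> real mat \<Rightarrow> bool" where
  "psd_mat m A \<longleftrightarrow> sym_mat m A \<and> (\<forall>v\<in>carrier_vec m. 0 \<le> scalar_prod v (mult_mat_vec A v))"

definition mtrace :: "'a::comm_monoid_add mat \<Rightarrow> 'a" where
  "mtrace A = (\<Sum>i<dim_row A. A $$ (i, i))"

definition linear_pencil :: "nat \<Rightarrow> nat \<Rightarrow> rpoly mat \<Rightarrow> bool" where
  "linear_pencil n m L \<longleftrightarrow> sym_mat m L \<and> elements_mat L \<subseteq> polys_deg_le n 1"

definition spectrahedron :: "nat \<Rightarrow> nat \<Rightarrow> rpoly mat \<Rightarrow> real vec set" where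
  "spectrahedron n m L = {x \<in> carrier_vec n. psd_mat m (map_mat (poly_eval x) L)}"

definition sos_mat :: "nat \<Rightarrow> nat \<Rightarrow> rpoly mat \<Rightarrow> bool" where
  "sos_mat n m S \<longleftrightarrow>
     (\<exists>r. \<exists>P\<in>carrier_mat r m. elements_mat P \<subseteq> polys_in n \<and> S = transpose_mat P * P)"

definition quadratic_sos_mat :: "nat \<Rightarrow> nat \<Rightarrow> rpoly mat \<Rightarrow> bool" where
  "quadratic_sos_mat n m S \<longleftrightarrow> sos_mat n m S \<and> elements_mat S \<subseteq> polys_deg_le n 2"


section \<open>The vector of all monomials up to a given degree\<close>

definition num_mons :: "nat \<Rightarrow> nat \<Rightarrow> nat" where
  "num_mons n d = (d + n) choose n"

text \<open>
  The library's linear order on exponent functions is lexicographic with the exponent at position 0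
  compared first, so within a fixed degree it lists the first variable last; the
  reversal restores the usual order, in which the first variable comes first.
\<close>

definition monomial_list :: "nat \<Rightarrow> nat \<Rightarrow> monomial list" where
  "monomial_list n d =
     concat (map (\<lambda>k. rev (sorted_list_of_set {a \<in> monomials_in n. mdeg a = k})) [0..<Suc d])"

definition monomial_vec :: "nat \<Rightarrow> nat \<Rightarrow> rpoly vec" where
  "monomial_vec n d = vec_of_list (map (\<lambda>a. Poly_Mapping.single a 1) (monomial_list n d))"

text \<open>
  The scalar obtained by multiplying A from the left by the transposed vector of monomials of
  degree at most d and from the right by the vector of monomials of degree at most e.
\<close>

definition gram_poly :: "nat \<Rightarrow> nat \<Rightarrow> nat \<Rightarrow> real mat \<Rightarrow> rpoly" where
  "gram_poly n d e A =
     scalar_prod (monomial_vec n d) (mult_mat_vec (map_mat Const A) (monomial_vec n e))"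

lemma mdeg_eq_sum: "a \<in> monomials_in n \<Longrightarrow> mdeg a = (\<Sum>i<n. Poly_Mapping.lookup a i)"
  unfolding mdeg_def monomials_in_def by (rule sum.mono_neutral_left) (auto simp: in_keys_iff)

lemma bij_betw_monomials:
  "bij_betw (\<lambda>a. map (Poly_Mapping.lookup a) [0..<n]) {a \<in> monomials_in n. mdeg a = k}
     {l. length l = n \<and> sum_list l = k}"
proof (rule bij_betwI')
  fix a b :: monomial
  assume "a \<in> {a \<in> monomials_in n. mdeg a = k}" "b \<in> {a \<in> monomials_in n. mdeg a = k}"
  then have ab: "Poly_Mapping.keys a \<subseteq> {..<n}" "Poly_Mapping.keys b \<subseteq> {..<n}" by (auto simp: monomials_in_def)
  show "map (Poly_Mapping.lookup a) [0..<n] = map (Poly_Mapping.lookup b) [0..<n] \<longleftrightarrow> a = b"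
  proof
    assume *: "map (Poly_Mapping.lookup a) [0..<n] = map (Poly_Mapping.lookup b) [0..<n]"
    show "a = b"
    proof (rule poly_mapping_eqI)
      fix i
      show "Poly_Mapping.lookup a i = Poly_Mapping.lookup b i"
      proof (cases "i < n")
        case False
        then have "i \<notin> Poly_Mapping.keys a" "i \<notin> Poly_Mapping.keys b" using ab by auto
        then show ?thesis by (simp add: in_keys_iff)
      qed (use * in auto)
    qed
  qed simp
next
  fix a :: monomial
  assume "a \<in> {a \<in> monomials_in n. mdeg a = k}"
  then show "map (Poly_Mapping.lookup a) [0..<n] \<in> {l. length l = n \<and> sum_list l = k}"
    by (auto simp: mdeg_eq_sum interv_sum_list_conv_sum_set_nat atLeast0LessThan)
next
  fix l :: "nat list"
  assume "l \<in> {l. length l = n \<and> sum_list l = k}"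
  then have l: "length l = n" "sum_list l = k" by auto
  define f where "f = (\<lambda>i. if i < n then l ! i else 0)"
  define a where "a = Abs_poly_mapping f"
  have "finite {i. f i \<noteq> 0}" by (rule finite_subset[of _ "{..<n}"]) (auto simp: f_def)
  then have look: "Poly_Mapping.lookup a = f" by (simp add: a_def)
  have a: "a \<in> monomials_in n"
    by (auto simp: monomials_in_def in_keys_iff look f_def split: if_splits)
  have m: "l = map (Poly_Mapping.lookup a) [0..<n]"
    by (rule nth_equalityI) (auto simp: l look f_def)
  have "mdeg a = k"
  proof -
    have "mdeg a = sum_list (map (Poly_Mapping.lookup a) [0..<n])"
      by (simp add: mdeg_eq_sum[OF a] interv_sum_list_conv_sum_set_nat atLeast0LessThan)
    then show ?thesis using l(2) m by simp
  qed
  with a m show "\<exists>a\<in>{a \<in> monomials_in n. mdeg a = k}. l = map (Poly_Mapping.lookup a) [0..<n]" by blast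
qed

lemma card_monomials: "card {a \<in> monomials_in n. mdeg a = k} = (k + n - 1) choose k"
  using bij_betw_same_card[OF bij_betw_monomials] by (simp add: card_length_sum_list)

lemma finite_monomials: "finite {a \<in> monomials_in n. mdeg a = k}"
proof -
  have "finite {l. set l \<subseteq> {..k} \<and> length l = n}" by (rule finite_lists_length_eq) simp
  then have "finite {l. length l = n \<and> sum_list l = k}"
    by (rule rev_finite_subset) (auto intro: member_le_sum_list)
  then show ?thesis using bij_betw_finite[OF bij_betw_monomials] by blast
qed

lemma set_monomial_list: "set (monomial_list n d) = {a \<in> monomials_in n. mdeg a \<le> d}"
  by (auto simp: monomial_list_def finite_monomials simp del: upt_Suc)

lemma length_monomial_list: "length (monomial_list n d) = num_mons n d"
proof -
  have "length (monomial_list n d) = (\<Sum>k\<le>d. (k + n - 1) choose k)"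
    by (simp add: monomial_list_def length_concat o_def card_monomials interv_sum_list_conv_sum_set_nat
        atLeast0LessThan lessThan_Suc_atMost del: upt_Suc)
  also have "\<dots> = (d + n) choose n"
  proof (cases n)
    case 0
    have "(\<Sum>k\<le>d. (k + n - 1) choose k) = (\<Sum>k\<le>d. if k = 0 then 1 else 0)"
      by (rule sum.cong) (auto simp: 0)
    then show ?thesis by (simp add: 0)
  next
    case (Suc r)
    have "(\<Sum>k\<le>d. (k + n - 1) choose k) = (\<Sum>k\<le>d. (r + k) choose k)"
      by (rule sum.cong) (auto simp: Suc add.commute)
    also have "\<dots> = Suc (r + d) choose d" by (rule sum_choose_lower)
    also have "Suc (r + d) = d + n" by (simp add: Suc)
    also have "(d + n) choose d = (d + n) choose n"
      using binomial_symmetric[of d "d + n"] by simp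
    finally show ?thesis .
  qed
  finally show ?thesis by (simp add: num_mons_def)
qed

lemma monomial_vec_carrier: "monomial_vec n d \<in> carrier_vec (num_mons n d)"
  by (rule carrier_vecI) (simp add: monomial_vec_def length_monomial_list)

lemma monomial_list_1: "monomial_list n 1 = 0 # map (\<lambda>i. Poly_Mapping.single i 1) [0..<n]"
proof -
  let ?x = "\<lambda>i. Poly_Mapping.single i 1 :: monomial"
  have 0: "{a \<in> monomials_in n. mdeg a = 0} = {0}"
    by (auto simp: monomials_in_def mdeg_def in_keys_iff intro!: poly_mapping_eqI)
  have less: "?x j < ?x i" if "i < j" for i j
  proof -
    have "less_fun (Poly_Mapping.lookup (?x j)) (Poly_Mapping.lookup (?x i))"
      unfolding less_fun_def
      by (rule exI[of _ i]) (use \<open>i < j\<close> in \<open>auto simp: lookup_single when_def\<close>)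
    then show ?thesis by (simp add: less_poly_mapping.rep_eq)
  qed
  have inj: "inj ?x"
  proof (rule injI)
    fix i j assume "?x i = ?x j"
    then show "i = j" using less[of i j] less[of j i] by (cases i j rule: linorder_cases) auto
  qed
  have sub: "?x ` {..<n} \<subseteq> {a \<in> monomials_in n. mdeg a = 1}"
    by (auto simp: monomials_in_def mdeg_def)
  have "card {a \<in> monomials_in n. mdeg a = 1} = n"
    unfolding card_monomials by (cases n) (simp_all add: choose_one)
  moreover have "card (?x ` {..<n}) = n"
    by (subst card_image[OF inj_on_subset[OF inj subset_UNIV]]) simp
  ultimately have 1: "{a \<in> monomials_in n. mdeg a = 1} = ?x ` {..<n}"
    using card_subset_eq[OF finite_monomials sub] by argo
  have 2: "sorted_list_of_set (?x ` {..<n}) = rev (map ?x [0..<n])"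
  proof (rule sorted_distinct_set_unique)
    show "sorted (rev (map ?x [0..<n]))"
      unfolding sorted_rev_iff_nth_mono
    proof (intro allI impI)
      fix i j assume "i \<le> j" "j < length (map ?x [0..<n])"
      then show "map ?x [0..<n] ! j \<le> map ?x [0..<n] ! i"
        using less[of i j] by (cases "i = j") auto
    qed
    show "distinct (rev (map ?x [0..<n]))"
      unfolding distinct_rev distinct_map
      by (rule conjI[OF distinct_upt inj_on_subset[OF inj subset_UNIV]])
    show "set (sorted_list_of_set (?x ` {..<n})) = set (rev (map ?x [0..<n]))"
      by (simp add: atLeast0LessThan)
  qed simp_all
  have "[0..<Suc 1] = [0, 1]" by (simp add: upt_rec)
  then show ?thesis unfolding monomial_list_def by (simp only: 0 1 2 list.map concat.simps rev_rev_ident) simp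
qed

end

theory Submission
  imports Defs
begin

text \<open>
  Soundness is a chain reaction. At a point of the spectrahedron \<open>tr(L S\<^sub>i)\<close> is nonnegative, and
  \<open>U\<^sub>i \<succeq> W\<^sub>i\<^sup>* W\<^sub>i\<close> makes the value of the first summand at least the sum of squares of the entries of
  \<open>W\<^sub>i X\<^sub>1\<close>. If \<open>W\<^sub>i\<^sub>-\<^sub>1 X\<^sub>1\<close> vanishes there, the equation of stage \<open>i\<close> forces this sum of squares to be
  zero, so \<open>W\<^sub>i X\<^sub>1\<close> vanishes as well (\<open>certificate_stage_vanishing\<close>). It starts at \<open>W\<^sub>0 = 0\<close> and ends
  with \<open>f = c + tr(L S)\<close> on the spectrahedron.

  For completeness, the entries of the \<open>W\<^sub>i X\<^sub>1\<close> are drawn from a growing subspace \<open>V\<close> of linear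
  polynomials that vanish on the spectrahedron. The subspace may be enlarged by \<open>l\<close> whenever
  \<open>l\<^sup>2 + tr(L S)\<close>, for some quadratic sos-matrix \<open>S\<close>, is a combination of members of \<open>V\<close> with
  coefficients of degree at most 2. One stage of the certificate pays for this, with
  \<open>U\<^sub>i = W\<^sub>i\<^sup>* W\<^sub>i\<close>: modulo \<open>V\<close>, each entry of \<open>W\<^sub>i X\<^sub>1\<close> is a multiple of \<open>l\<close>, so the polynomial of
  \<open>U\<^sub>i\<close> is a nonnegative multiple of \<open>l\<^sup>2\<close> (\<open>certified_ideal_Suc\<close>). Here the matrices are chosen
  backwards, from \<open>W\<^sub>n\<close> down to \<open>W\<^sub>0\<close>.

  Each enlargement raises the dimension. After \<open>n\<close> stages either no further enlargement is possible
  (\<open>V\<close> is \<open>sos_closed\<close>), or \<open>V\<close> has dimension \<open>n\<close> and so, if it does not contain 1, cuts out a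
  single point. In the second case, \<open>f\<close> is a constant modulo \<open>V\<close> and the claim is a matter of signs
  (\<open>hyperplane_separation\<close>).

  In the first case, write \<open>l\<^sub>u = u\<^sup>* L u\<close>. Two explicit identities show that a closed \<open>V\<close> not
  containing 1 behaves like a face: if \<open>c + l\<^sub>u + l\<^sub>v + \<dots>\<close> lies in \<open>V\<close> with \<open>c \<ge> 0\<close>, then \<open>c = 0\<close> and
  all the summands lie in \<open>V\<close>; and if \<open>l\<^sub>u\<close> lies in \<open>V\<close>, so does \<open>w\<^sup>* L u\<close> for every \<open>w\<close>
  (\<open>sos_closed_face\<close>, \<open>sos_closed_kernel\<close>). This is what exact conic duality needs
  (\<open>quadratic_values_alternative\<close>): after restricting to coordinates complementary to the common
  kernel of \<open>L\<close> modulo \<open>V\<close>, there is a linear functional at which the pencil is positive definite. This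
  value of the pencil serves as an order unit for extending nonnegative functionals from the range of
  the pencil to all matrices, and a functional that is nonnegative on positive semidefinite matrices is
  the trace pairing with a sum of \<open>u u\<^sup>*\<close>. Consequently \<open>f\<close> lies in the cone of all
  \<open>c + l\<^sub>u + l\<^sub>v + \<dots>\<close> modulo \<open>V\<close>, or a linear functional separates it from that cone. A separating functional with value 1 at 1 is evaluation at a
  point of the spectrahedron at which \<open>f\<close> is negative.
\<close>

section \<open>Bilinear forms with values in a real vector space\<close>

definition bil :: "nat set \<Rightarrow> (nat \<Rightarrow> nat \<Rightarrow> 'a::real_vector) \<Rightarrow> (nat \<Rightarrow> real) \<Rightarrow> (nat \<Rightarrow> real) \<Rightarrow> 'a"
  where "bil I B u w = (\<Sum>i\<in>I. \<Sum>j\<in>I. (u i * w j) *\<^sub>R B i j)"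

definition supported :: "nat set \<Rightarrow> (nat \<Rightarrow> real) \<Rightarrow> bool"
  where "supported I u \<longleftrightarrow> (\<forall>i. i \<notin> I \<longrightarrow> u i = 0)"

lemma sum_list_map_eq_zero:
  assumes "\<And>x. x \<in> set xs \<Longrightarrow> f x = 0"
  shows "(\<Sum>x\<leftarrow>xs. f x) = (0::'a::monoid_add)"
  using assms by (induction xs) auto

lemma bil_add_left: "bil I B (\<lambda>i. u i + v i) w = bil I B u w + bil I B v w"
  by (simp add: bil_def algebra_simps sum.distrib)

lemma bil_add_right: "bil I B u (\<lambda>i. v i + w i) = bil I B u v + bil I B u w"
  by (simp add: bil_def algebra_simps sum.distrib)

lemma bil_scale_left: "bil I B (\<lambda>i. c * u i) w = c *\<^sub>R bil I B u w"
  by (simp add: bil_def scaleR_sum_right mult.assoc)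

lemma bil_scale_right: "bil I B u (\<lambda>i. c * w i) = c *\<^sub>R bil I B u w"
  by (simp add: bil_def scaleR_sum_right mult.left_commute mult.assoc)

lemma bil_scale_form: "bil I (\<lambda>i j. c *\<^sub>R B i j) u w = c *\<^sub>R bil I B u w"
  by (simp add: bil_def scaleR_sum_right mult_ac)

lemma bil_add_form: "bil I (\<lambda>i j. B i j + C i j) u w = bil I B u w + bil I C u w"
  by (simp add: bil_def algebra_simps sum.distrib)

lemma bil_commute:
  assumes "\<And>i j. i \<in> I \<Longrightarrow> j \<in> I \<Longrightarrow> B i j = B j i"
  shows "bil I B u w = bil I B w u"
  unfolding bil_def by (subst sum.swap) (auto intro!: sum.cong simp: assms mult.commute)

lemma bil_linear:
  assumes "linear h"
  shows "h (bil I B u w) = bil I (\<lambda>i j. h (B i j)) u w"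
  by (simp add: bil_def linear_sum[OF assms] linear_scale[OF assms])

lemma bil_restrict:
  assumes "finite I" "J \<subseteq> I" "supported J u" "supported J w"
  shows "bil I B u w = bil J B u w"
proof -
  have "bil I B u w = (\<Sum>i\<in>I. \<Sum>j\<in>J. (u i * w j) *\<^sub>R B i j)"
    unfolding bil_def using assms
    by (intro sum.cong refl sum.mono_neutral_right) (auto simp: supported_def)
  also have "\<dots> = bil J B u w"
    unfolding bil_def using assms
    by (intro sum.mono_neutral_right) (auto simp: supported_def)
  finally show ?thesis .
qed

lemma bil_cong:
  assumes "\<And>i. i \<in> I \<Longrightarrow> u i = u' i" "\<And>i. i \<in> I \<Longrightarrow> w i = w' i"
    and "\<And>i j. i \<in> I \<Longrightarrow> j \<in> I \<Longrightarrow> B i j = B' i j"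
  shows "bil I B u w = bil I B' u' w'"
  using assms by (auto simp: bil_def intro!: sum.cong)

lemma bil_rank_one:
  fixes u w :: "nat \<Rightarrow> real"
  shows "bil I (\<lambda>i j. x i * y j) u w = (\<Sum>i\<in>I. u i * x i) * (\<Sum>j\<in>I. w j * y j)"
  by (simp add: bil_def sum_product mult_ac)

section \<open>Positive functionals on symmetric matrices\<close>

text \<open>
  Cholesky elimination, one index at a time. If \<open>S k k\<close> is positive, subtracting \<open>x x\<^sup>*\<close> for the scaled
  row \<open>x\<close> at \<open>k\<close> clears row and column \<open>k\<close>, and the rest is the Schur complement: its value at \<open>u\<close> is
  the minimum of the old form over the choice of the entry at \<open>k\<close>. If \<open>S k k = 0\<close>, row \<open>k\<close> is already
  zero, since otherwise the form would be linear and unbounded in that entry.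
\<close>

lemma psd_sum_of_squares:
  fixes S :: "nat \<Rightarrow> nat \<Rightarrow> real"
  assumes "finite J"
    and "\<And>i j. i \<in> J \<Longrightarrow> j \<in> J \<Longrightarrow> S i j = S j i"
    and "\<And>u. 0 \<le> bil J S u u"
  shows "\<exists>us. (\<forall>u\<in>set us. supported J u) \<and> (\<forall>i\<in>J. \<forall>j\<in>J. S i j = (\<Sum>u\<leftarrow>us. u i * u j))"
  using assms
proof (induction J arbitrary: S rule: finite_induct)
  case empty
  show ?case by (rule exI[of _ "[]"]) simp
next
  case (insert k J)
  have expand: "bil (insert k J) S u u =
      (u k)\<^sup>2 * S k k + 2 * u k * (\<Sum>j\<in>J. u j * S k j) + bil J S u u" for u
  proof -
    have "bil (insert k J) S u u = (u k)\<^sup>2 * S k k + (\<Sum>j\<in>J. u k * u j * S k j)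
        + (\<Sum>i\<in>J. u i * u k * S i k) + bil J S u u"
      using insert.hyps by (simp add: bil_def sum.distrib power2_eq_square algebra_simps)
    moreover have "(\<Sum>i\<in>J. u i * u k * S i k) = (\<Sum>j\<in>J. u k * u j * S k j)"
      by (rule sum.cong) (use insert.prems(1)[of k] in auto)
    ultimately show ?thesis by (simp add: sum_distrib_left mult_ac)
  qed
  have diag: "0 \<le> S k k"
  proof -
    define u where "u = (\<lambda>i. if i = k then 1 else (0::real))"
    have "(\<Sum>j\<in>J. u j * S k j) = 0" "bil J S u u = 0"
      using insert.hyps by (auto simp: u_def bil_def intro!: sum.neutral)
    then show ?thesis using insert.prems(2)[of u] unfolding expand by (simp add: u_def)
  qed
  define x where "x = (\<lambda>i. if i \<in> insert k J then S k i / sqrt (S k k) else 0)"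
  have zero: "S k i = 0" if "S k k = 0" "i \<in> J" for i
  proof (rule ccontr)
    assume nz: "S k i \<noteq> 0"
    have ik: "i \<noteq> k" using that insert.hyps by auto
    \<comment> \<open>At the vector with entry t at k and 1 at i, the form has the value
      \<open>2 t S k i + S i i\<close>, which is -1 for this t.\<close>
    define t where "t = - (S i i + 1) / (2 * S k i)"
    define u where "u = (\<lambda>j. if j = k then t else if j = i then 1 else (0::real))"
    have 1: "(\<Sum>j\<in>J. u j * S k j) = S k i"
    proof -
      have "(\<Sum>j\<in>J. u j * S k j) = (\<Sum>j\<in>J. if j = i then S k i else 0)"
        by (rule sum.cong) (use insert.hyps in \<open>auto simp: u_def\<close>)
      then show ?thesis using insert.hyps that by simp
    qed
    have 2: "bil J S u u = S i i"
    proof -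
      have "bil J S u u = bil {i} S u u"
      proof -
        have "bil J S u u = bil J S (\<lambda>j. if j = i then 1 else 0) (\<lambda>j. if j = i then 1 else 0)"
          by (rule bil_cong) (use insert.hyps in \<open>auto simp: u_def\<close>)
        also have "\<dots> = bil {i} S (\<lambda>j. if j = i then 1 else 0) (\<lambda>j. if j = i then 1 else 0)"
          by (rule bil_restrict) (use insert.hyps that in \<open>auto simp: supported_def\<close>)
        finally show ?thesis using ik by (simp add: bil_def u_def)
      qed
      then show ?thesis using ik by (simp add: bil_def u_def)
    qed
    have "0 \<le> 2 * t * S k i + S i i"
      using insert.prems(2)[of u] unfolding expand 1 2 using that by (simp add: u_def)
    moreover have "2 * t * S k i = - (S i i + 1)" using nz by (simp add: t_def)
    ultimately show False by linarith
  qed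
  have xk: "x k * x i = S k i" if "i \<in> insert k J" for i
    using that diag zero by (cases "S k k = 0") (auto simp: x_def)
  define S' where "S' = (\<lambda>i j. S i j - x i * x j)"
  have sym': "S' i j = S' j i" if "i \<in> J" "j \<in> J" for i j
    using insert.prems(1)[of i j] that by (simp add: S'_def)
  have psd': "0 \<le> bil J S' u u" for u
  proof -
    define s where "s = (\<Sum>j\<in>J. u j * x j)"
    have S'_bil: "bil J S' u u = bil J S u u - s\<^sup>2"
      using bil_add_form[of J S "\<lambda>i j. (-1) *\<^sub>R (x i * x j)" u u] bil_rank_one[of J x x u u]
        bil_scale_form[of J "-1" "\<lambda>i j. x i * x j" u u]
      by (simp add: S'_def s_def power2_eq_square)
    show ?thesis
    proof (cases "S k k = 0")
      case True
      then have "x i = 0" for i by (simp add: x_def)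
      then have "bil J S' u u = bil J S u u" using S'_bil by (simp add: s_def)
      also have "\<dots> = bil (insert k J) S (u(k := 0)) (u(k := 0))"
        unfolding expand using insert.hyps by (auto intro!: bil_cong)
      finally show ?thesis using insert.prems(2) by simp
    next
      case False
      then have pos: "x k > 0" "x k * x k = S k k" using diag xk[of k] by (auto simp: x_def)
      \<comment> \<open>This entry at k minimises the form \<open>S\<close> among all vectors that agree with u on J.\<close>
      define v where "v = u(k := - s / x k)"
      have "(\<Sum>j\<in>J. v j * S k j) = x k * s"
        unfolding s_def sum_distrib_left
        by (rule sum.cong) (use xk insert.hyps in \<open>auto simp: v_def algebra_simps\<close>)
      moreover have "bil J S v v = bil J S u u"
        by (rule bil_cong) (use insert.hyps in \<open>auto simp: v_def\<close>)
      ultimately have "bil (insert k J) S v v = bil J S u u - s\<^sup>2"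
        unfolding expand using pos
        by (simp add: v_def power2_eq_square field_simps flip: pos(2))
      then show ?thesis using S'_bil insert.prems(2)[of v] by simp
    qed
  qed
  obtain us where us: "\<And>u. u \<in> set us \<Longrightarrow> supported J u"
    and S'_us: "\<And>i j. i \<in> J \<Longrightarrow> j \<in> J \<Longrightarrow> S' i j = (\<Sum>u\<leftarrow>us. u i * u j)"
    using insert.IH[OF sym' psd'] by blast
  have us_k: "u k = 0" if "u \<in> set us" for u
    using us[OF that] insert.hyps by (simp add: supported_def)
  then have sum_k: "(\<Sum>u\<leftarrow>us. u k * u i) = 0" "(\<Sum>u\<leftarrow>us. u i * u k) = 0" for i
    by (simp_all add: us_k sum_list_map_eq_zero)
  show ?case
  proof (intro exI[of _ "x # us"] conjI ballI)
    fix u assume "u \<in> set (x # us)"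
    then show "supported (insert k J) u"
      using us by (auto simp: supported_def x_def)
  next
    fix i j assume ij: "i \<in> insert k J" "j \<in> insert k J"
    then show "S i j = (\<Sum>u\<leftarrow>x # us. u i * u j)"
      using S'_us[of i j] xk[of i] xk[of j] insert.prems(1)[of i j] us_k sum_k
      by (auto simp: S'_def mult.commute)
  qed
qed

text \<open>
  The one-dimensional step of the Riesz extension theorem. \<open>R\<close> is the graph of a linear functional that is
  nonnegative on the cone \<open>P\<close>; the functional receives the value \<open>a\<close> on the new direction \<open>z\<close>. Each
  element of the graph whose translate by \<open>z\<close> or \<open>- z\<close> lies in \<open>P\<close> bounds \<open>a\<close> from below or above, any
  lower bound is at most any upper bound because \<open>P\<close> is closed under addition, and the order unit \<open>e\<close>
  provides bounds on both sides. Using graphs avoids deciding whether \<open>z\<close> is already in the domain.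
\<close>

lemma order_unit_extension_step:
  fixes R :: "(('i \<Rightarrow> real) \<times> real) set" and P :: "('i \<Rightarrow> real) set"
  assumes R_add: "\<And>y r z s. (y, r) \<in> R \<Longrightarrow> (z, s) \<in> R \<Longrightarrow> (\<lambda>i. y i + z i, r + s) \<in> R"
    and R_scale: "\<And>y r t. (y, r) \<in> R \<Longrightarrow> (\<lambda>i. t * y i, t * r) \<in> R"
    and P_add: "\<And>y z. y \<in> P \<Longrightarrow> z \<in> P \<Longrightarrow> (\<lambda>i. y i + z i) \<in> P"
    and P_scale: "\<And>y t. y \<in> P \<Longrightarrow> 0 \<le> t \<Longrightarrow> (\<lambda>i. t * y i) \<in> P"
    and pos: "\<And>y r. (y, r) \<in> R \<Longrightarrow> y \<in> P \<Longrightarrow> 0 \<le> r"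
    and unit: "(e, c) \<in> R" "\<And>y. \<exists>t. (\<lambda>i. y i + t * e i) \<in> P"
  shows "\<exists>a. \<forall>(y, r)\<in>R. \<forall>t. (\<lambda>i. y i + t * z i) \<in> P \<longrightarrow> 0 \<le> r + t * a"
proof -
  define A where "A = {- r |y r. (y, r) \<in> R \<and> (\<lambda>i. y i + z i) \<in> P}"
  have between: "x \<le> r" if "x \<in> A" "(y, r) \<in> R" "(\<lambda>i. y i - z i) \<in> P" for x y r
  proof -
    obtain y' r' where *: "x = - r'" "(y', r') \<in> R" "(\<lambda>i. y' i + z i) \<in> P"
      using \<open>x \<in> A\<close> by (auto simp: A_def)
    have "(\<lambda>i. y' i + y i) \<in> P" using P_add[OF *(3) that(3)] by simp
    then have "0 \<le> r' + r" by (rule pos[OF R_add[OF *(2) that(2)]])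
    then show ?thesis using * by simp
  qed
  obtain t where "(\<lambda>i. z i + t * e i) \<in> P" using unit(2) by blast
  then have "- (t * c) \<in> A" using R_scale[OF unit(1), of t] by (force simp: A_def add.commute)
  then have nonempty: "A \<noteq> {}" by auto
  obtain s where s: "(\<lambda>i. - z i + s * e i) \<in> P" using unit(2)[of "\<lambda>i. - z i"] by blast
  have bdd: "bdd_above A"
    by (rule bdd_aboveI[of _ "s * c"], rule between[OF _ R_scale[OF unit(1), of s]])
      (use s in simp_all)
  define a where "a = Sup A"
  show ?thesis
  proof (intro exI[of _ a] ballI allI impI, clarify)
    fix y r t assume R: "(y, r) \<in> R" and P: "(\<lambda>i. y i + t * z i) \<in> P"
    consider "t = 0" | "t > 0" | "t < 0" by linarith
    then show "0 \<le> r + t * a"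
    proof cases
      case 1
      then show ?thesis using pos[OF R] P by simp
    next
      case 2
      have "(\<lambda>i. (1/t) * y i + z i) \<in> P" using P_scale[OF P, of "1/t"] 2 by (simp add: field_simps)
      then have "- ((1/t) * r) \<in> A" using R_scale[OF R, of "1/t"] by (force simp: A_def)
      then have "- ((1/t) * r) \<le> a" unfolding a_def by (rule cSup_upper[OF _ bdd])
      then show ?thesis using 2 by (simp add: field_simps)
    next
      case 3
      have "(\<lambda>i. (-1/t) * y i - z i) \<in> P"
        using P_scale[OF P, of "-1/t"] 3 by (simp add: diff_divide_distrib add_divide_distrib)
      then have "a \<le> (-1/t) * r"
        unfolding a_def by (intro cSup_least[OF nonempty] between[OF _ R_scale[OF R]])
      then show ?thesis using 3 by (simp add: field_simps)
    qed
  qed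
qed

text \<open>
  Adjoins the coordinate directions of \<open>K\<close> one after the other; \<open>a\<close> collects the values chosen there.
\<close>

lemma order_unit_extension:
  fixes R :: "(('i \<Rightarrow> real) \<times> real) set" and P :: "('i \<Rightarrow> real) set"
  assumes R_add: "\<And>y r z s. (y, r) \<in> R \<Longrightarrow> (z, s) \<in> R \<Longrightarrow> (\<lambda>i. y i + z i, r + s) \<in> R"
    and R_scale: "\<And>y r t. (y, r) \<in> R \<Longrightarrow> (\<lambda>i. t * y i, t * r) \<in> R"
    and P_add: "\<And>y z. y \<in> P \<Longrightarrow> z \<in> P \<Longrightarrow> (\<lambda>i. y i + z i) \<in> P"
    and P_scale: "\<And>y t. y \<in> P \<Longrightarrow> 0 \<le> t \<Longrightarrow> (\<lambda>i. t * y i) \<in> P"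
    and pos: "\<And>y r. (y, r) \<in> R \<Longrightarrow> y \<in> P \<Longrightarrow> 0 \<le> r"
    and unit: "(e, c) \<in> R" "\<And>y. \<exists>t. (\<lambda>i. y i + t * e i) \<in> P"
    and "finite K"
  shows "\<exists>a. \<forall>(y, r)\<in>R. \<forall>t. (\<lambda>i. if i \<in> K then y i + t i else y i) \<in> P \<longrightarrow>
    0 \<le> r + (\<Sum>i\<in>K. t i * a i)"
  using \<open>finite K\<close>
proof (induction K rule: finite_induct)
  case empty
  then show ?case using pos by auto
next
  case (insert k K)
  from insert.IH obtain a where a: "\<And>y r t. (y, r) \<in> R \<Longrightarrow>
      (\<lambda>i. if i \<in> K then y i + t i else y i) \<in> P \<Longrightarrow> 0 \<le> r + (\<Sum>i\<in>K. t i * a i)"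
    by blast
  define R' where "R' = {(\<lambda>i. if i \<in> K then y i + t i else y i, r + (\<Sum>i\<in>K. t i * a i)) |y r t. (y, r) \<in> R}"
  have "\<exists>b. \<forall>(y, r)\<in>R'. \<forall>t. (\<lambda>i. y i + t * (if i = k then 1 else 0)) \<in> P \<longrightarrow> 0 \<le> r + t * b"
  proof (rule order_unit_extension_step[OF _ _ P_add P_scale])
    fix y r z s assume "(y, r) \<in> R'" "(z, s) \<in> R'"
    then obtain y' r' t z' s' t' where *: "(y', r') \<in> R" "(z', s') \<in> R"
      "y = (\<lambda>i. if i \<in> K then y' i + t i else y' i)" "r = r' + (\<Sum>i\<in>K. t i * a i)"
      "z = (\<lambda>i. if i \<in> K then z' i + t' i else z' i)" "s = s' + (\<Sum>i\<in>K. t' i * a i)"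
      by (auto simp: R'_def)
    then show "(\<lambda>i. y i + z i, r + s) \<in> R'"
      unfolding R'_def using R_add[OF *(1,2)]
      by (intro CollectI exI[of _ "\<lambda>i. y' i + z' i"] exI[of _ "r' + s'"] exI[of _ "\<lambda>i. t i + t' i"])
        (auto simp: algebra_simps sum.distrib)
  next
    fix y r q assume "(y, r) \<in> R'"
    then obtain y' r' t where *: "(y', r') \<in> R"
      "y = (\<lambda>i. if i \<in> K then y' i + t i else y' i)" "r = r' + (\<Sum>i\<in>K. t i * a i)"
      by (auto simp: R'_def)
    then show "(\<lambda>i. q * y i, q * r) \<in> R'"
      unfolding R'_def using R_scale[OF *(1), of q]
      by (intro CollectI exI[of _ "\<lambda>i. q * y' i"] exI[of _ "q * r'"] exI[of _ "\<lambda>i. q * t i"])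
        (auto simp: algebra_simps sum_distrib_left)
  next
    fix y r assume "(y, r) \<in> R'" "y \<in> P"
    then show "0 \<le> r" using a by (auto simp: R'_def)
  next
    show "(e, c) \<in> R'" unfolding R'_def using unit(1)
      by (intro CollectI exI[of _ e] exI[of _ c] exI[of _ "\<lambda>_. 0"]) auto
  qed (use unit in auto)
  then obtain b where b: "\<And>y r t. (y, r) \<in> R' \<Longrightarrow>
      (\<lambda>i. y i + t * (if i = k then 1 else 0)) \<in> P \<Longrightarrow> 0 \<le> r + t * b"
    by blast
  show ?case
  proof (intro exI[of _ "a(k := b)"] ballI allI impI, clarify)
    fix y r t assume R: "(y, r) \<in> R" and P: "(\<lambda>i. if i \<in> insert k K then y i + t i else y i) \<in> P"
    let ?y = "\<lambda>i. if i \<in> K then y i + t i else y i"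
    have "(?y, r + (\<Sum>i\<in>K. t i * a i)) \<in> R'" unfolding R'_def using R by blast
    moreover have "(\<lambda>i. ?y i + t k * (if i = k then 1 else 0)) \<in> P"
      using P insert.hyps by (auto elim!: back_subst[of "\<lambda>y. y \<in> P"])
    ultimately have "0 \<le> r + (\<Sum>i\<in>K. t i * a i) + t k * b" by (rule b)
    also have "(\<Sum>i\<in>K. t i * a i) = (\<Sum>i\<in>K. t i * (a(k := b)) i)"
      by (rule sum.cong) (use insert.hyps in auto)
    finally show "0 \<le> r + (\<Sum>i\<in>insert k K. t i * (a(k := b)) i)"
      using insert.hyps by (simp add: algebra_simps)
  qed
qed

text \<open>
  A form that dominates the sum of squares is an order unit, since the entries of \<open>y\<close> bound its values
  against the sum of squares.
\<close>

lemma bil_order_unit: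
  fixes y :: "nat \<Rightarrow> nat \<Rightarrow> real"
  assumes "finite J" "\<And>u. (\<Sum>i\<in>J. (u i)\<^sup>2) \<le> bil J e u u"
  shows "\<exists>t. \<forall>u. 0 \<le> bil J (\<lambda>i j. y i j + t * e i j) u u"
proof -
  define t where "t = (\<Sum>i\<in>J. \<Sum>j\<in>J. \<bar>y i j\<bar>)"
  have t0: "0 \<le> t" unfolding t_def by (intro sum_nonneg) auto
  have "0 \<le> bil J (\<lambda>i j. y i j + t * e i j) u u" for u
  proof -
    define s where "s = (\<Sum>i\<in>J. (u i)\<^sup>2)"
    have le: "(u i)\<^sup>2 \<le> s" if "i \<in> J" for i
      unfolding s_def using \<open>finite J\<close> that by (intro member_le_sum) auto
    have prod: "\<bar>u i * u j\<bar> \<le> s" if "i \<in> J" "j \<in> J" for i j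
    proof -
      have "2 * \<bar>u i * u j\<bar> \<le> (u i)\<^sup>2 + (u j)\<^sup>2"
        using sum_squares_bound[of "\<bar>u i\<bar>" "\<bar>u j\<bar>"] by (simp add: abs_mult)
      then show ?thesis using le[OF that(1)] le[OF that(2)] by linarith
    qed
    have "- bil J y u u = (\<Sum>i\<in>J. \<Sum>j\<in>J. - (u i * u j * y i j))"
      by (simp add: bil_def sum_negf)
    also have "\<dots> \<le> (\<Sum>i\<in>J. \<Sum>j\<in>J. s * \<bar>y i j\<bar>)"
    proof (intro sum_mono)
      fix i j assume "i \<in> J" "j \<in> J"
      have "- (u i * u j * y i j) \<le> \<bar>u i * u j\<bar> * \<bar>y i j\<bar>" by (metis abs_ge_minus_self abs_mult)
      also have "\<dots> \<le> s * \<bar>y i j\<bar>" using \<open>i \<in> J\<close> \<open>j \<in> J\<close> by (intro mult_right_mono prod) auto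
      finally show "- (u i * u j * y i j) \<le> s * \<bar>y i j\<bar>" .
    qed
    also have "\<dots> = t * s" by (simp add: t_def sum_distrib_left mult.commute)
    also have "\<dots> \<le> t * bil J e u u" using assms(2) t0 by (simp add: s_def mult_left_mono)
    finally show ?thesis
      using bil_add_form[of J y "\<lambda>i j. t *\<^sub>R e i j" u u] bil_scale_form[of J t e u u] by simp
  qed
  then show ?thesis by blast
qed

text \<open>
  Let a functional on a space of matrices be nonnegative on those with nonnegative quadratic form, whether
  symmetric or not, and let its domain contain an order unit. Then it extends to a nonnegative functional
  on all matrices, which is the pairing with a matrix \<open>S\<close>. Testing it on \<open>u u\<^sup>*\<close> shows that \<open>S\<close> is
  positive semidefinite. Testing it on skew-symmetric matrices, whose quadratic form is zero, shows that
  \<open>S\<close> is symmetric. So \<open>S\<close> is a sum of \<open>u u\<^sup>*\<close>.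
\<close>

lemma psd_positive_functional_sos:
  fixes R :: "((nat \<Rightarrow> nat \<Rightarrow> real) \<times> real) set"
  assumes "finite J"
    and R_add: "\<And>y r z s. (y, r) \<in> R \<Longrightarrow> (z, s) \<in> R \<Longrightarrow> (\<lambda>i j. y i j + z i j, r + s) \<in> R"
    and R_scale: "\<And>y r t. (y, r) \<in> R \<Longrightarrow> (\<lambda>i j. t * y i j, t * r) \<in> R"
    and pos: "\<And>y r. (y, r) \<in> R \<Longrightarrow> (\<And>u. supported J u \<Longrightarrow> 0 \<le> bil J y u u) \<Longrightarrow> 0 \<le> r"
    and unit: "(e, c) \<in> R" "\<And>u. supported J u \<Longrightarrow> (\<Sum>i\<in>J. (u i)\<^sup>2) \<le> bil J e u u"
  shows "\<exists>us. (\<forall>u\<in>set us. supported J u) \<and> (\<forall>(y, r)\<in>R. r = (\<Sum>u\<leftarrow>us. bil J y u u))"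
proof -
  define P :: "(nat \<times> nat \<Rightarrow> real) set" where "P = {y. \<forall>u. 0 \<le> bil J (curry y) u u}"
  define Q where "Q = {(y, r). (curry y, r) \<in> R}"
  have Q_iff: "(y, r) \<in> Q \<longleftrightarrow> (curry y, r) \<in> R" for y r
    by (simp add: Q_def)
  have restrict: "bil J y (\<lambda>i. if i \<in> J then u i else 0) (\<lambda>i. if i \<in> J then u i else 0) = bil J y u u"
    for y :: "nat \<Rightarrow> nat \<Rightarrow> real" and u by (rule bil_cong) auto
  have unit': "(\<Sum>i\<in>J. (u i)\<^sup>2) \<le> bil J e u u" for u
    using unit(2)[of "\<lambda>i. if i \<in> J then u i else 0"] unfolding restrict by (simp add: supported_def)
  have P_scale: "(\<lambda>i. t * y i) \<in> P" if "y \<in> P" "0 \<le> t" for y t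
    using that bil_scale_form[of J t "curry y"] by (simp add: P_def curry_def)
  have P_add: "(\<lambda>i. y i + z i) \<in> P" if "y \<in> P" "z \<in> P" for y z
    using that bil_add_form[of J "curry y" "curry z"] by (simp add: P_def curry_def)
  have "\<exists>a. \<forall>(y, r)\<in>Q. \<forall>t. (\<lambda>i. if i \<in> J \<times> J then y i + t i else y i) \<in> P \<longrightarrow>
      0 \<le> r + (\<Sum>i\<in>J \<times> J. t i * a i)"
  proof (rule order_unit_extension)
    show "(case_prod e, c) \<in> Q" using unit(1) by (simp add: Q_iff)
    show "0 \<le> r" if "(y, r) \<in> Q" "y \<in> P" for y r
      using that pos by (simp add: Q_iff P_def)
    show "\<exists>t. (\<lambda>i. y i + t * case_prod e i) \<in> P" for y
      using bil_order_unit[OF \<open>finite J\<close> unit', of "curry y"] by (simp add: P_def curry_def)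
  qed (use R_add R_scale P_add P_scale \<open>finite J\<close> in \<open>auto simp: Q_iff curry_def\<close>)
  then obtain a where a: "\<And>y r t. (y, r) \<in> Q \<Longrightarrow>
      (\<lambda>i. if i \<in> J \<times> J then y i + t i else y i) \<in> P \<Longrightarrow> 0 \<le> r + (\<Sum>i\<in>J \<times> J. t i * a i)"
    by blast
  define S where "S = curry a"
  have zero_Q: "(\<lambda>_. 0, 0) \<in> Q" using R_scale[OF unit(1), of 0] by (simp add: Q_iff curry_def)
  have a_pos: "0 \<le> (\<Sum>i\<in>J. \<Sum>j\<in>J. y i j * S i j)" if "\<And>u. 0 \<le> bil J y u u" for y
  proof -
    have "(\<lambda>i. if i \<in> J \<times> J then (\<lambda>_. 0) i + case_prod y i else (\<lambda>_. 0) i) \<in> P"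
      unfolding P_def
    proof (intro CollectI allI)
      fix u
      have "bil J (curry (\<lambda>i. if i \<in> J \<times> J then 0 + case_prod y i else 0)) u u = bil J y u u"
        by (rule bil_cong) auto
      then show "0 \<le> bil J (curry (\<lambda>i. if i \<in> J \<times> J then 0 + case_prod y i else 0)) u u"
        using that by simp
    qed
    from a[OF zero_Q this] show ?thesis
      by (simp add: sum.cartesian_product S_def case_prod_unfold)
  qed
  have S_sym: "S i j = S j i" if ij: "i \<in> J" "j \<in> J" for i j
  proof -
    have ge: "0 \<le> S i j - S j i" if "i \<in> J" "j \<in> J" for i j
    proof (cases "i = j")
      case False
      define d where "d = (\<lambda>k l. (if k = i then 1 else 0) * (if l = j then 1 else 0)
        + (-1) *\<^sub>R ((if k = j then 1 else 0) * (if l = i then 1 else (0::real))))"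
      have "bil J d u u = 0" for u
        unfolding d_def bil_add_form bil_scale_form bil_rank_one by simp
      then have "0 \<le> (\<Sum>k\<in>J. \<Sum>l\<in>J. d k l * S k l)" by (intro a_pos) simp
      also have "(\<Sum>k\<in>J. \<Sum>l\<in>J. d k l * S k l) =
          (\<Sum>k\<in>J. if k = i then (\<Sum>l\<in>J. if l = j then S k l else 0) else 0) -
          (\<Sum>k\<in>J. if k = j then (\<Sum>l\<in>J. if l = i then S k l else 0) else 0)"
        unfolding sum_subtractf[symmetric]
        by (rule sum.cong) (auto simp: d_def sum_subtractf[symmetric] sum_negf[symmetric] intro!: sum.cong)
      finally show ?thesis using that \<open>finite J\<close> by simp
    qed simp
    show ?thesis using ge[OF ij] ge[OF ij(2,1)] by simp
  qed
  have S_psd: "0 \<le> bil J S u u" for u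
  proof -
    have "0 \<le> (\<Sum>i\<in>J. \<Sum>j\<in>J. (u i * u j) * S i j)"
      by (rule a_pos) (simp add: bil_rank_one)
    then show ?thesis by (simp add: bil_def)
  qed
  obtain us where us: "\<And>u. u \<in> set us \<Longrightarrow> supported J u"
    and S_us: "\<And>i j. i \<in> J \<Longrightarrow> j \<in> J \<Longrightarrow> S i j = (\<Sum>u\<leftarrow>us. u i * u j)"
    using psd_sum_of_squares[OF \<open>finite J\<close> S_sym S_psd] by blast
  have S_sum: "(\<Sum>i\<in>J. \<Sum>j\<in>J. y i j * S i j) = (\<Sum>u\<leftarrow>us. bil J y u u)" for y
  proof -
    have "(\<Sum>i\<in>J. \<Sum>j\<in>J. y i j * (\<Sum>u\<leftarrow>us. u i * u j)) = (\<Sum>u\<leftarrow>us. bil J y u u)"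
      by (induction us) (simp_all add: bil_def algebra_simps sum.distrib)
    then show ?thesis by (simp add: S_us)
  qed
  have ge: "(\<Sum>u\<leftarrow>us. bil J y u u) \<le> r" if "(y, r) \<in> R" for y r
  proof -
    have "(case_prod y, r) \<in> Q" using that by (simp add: Q_iff)
    moreover have "(\<lambda>i. if i \<in> J \<times> J then case_prod y i + (- case_prod y i) else case_prod y i) \<in> P"
      unfolding P_def
    proof (intro CollectI allI)
      fix u
      have "bil J (curry (\<lambda>i. if i \<in> J \<times> J then case_prod y i + (- case_prod y i) else case_prod y i)) u u
          = bil J (\<lambda>_ _. 0) u u"
        by (rule bil_cong) auto
      then show "0 \<le> bil J (curry (\<lambda>i. if i \<in> J \<times> J then case_prod y i + (- case_prod y i) else case_prod y i)) u u"
        by (simp add: bil_def)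
    qed
    ultimately have "0 \<le> r + (\<Sum>i\<in>J \<times> J. - case_prod y i * a i)" by (rule a)
    then show ?thesis
      unfolding S_sum[symmetric] by (simp add: sum.cartesian_product S_def case_prod_unfold sum_negf)
  qed
  have "r = (\<Sum>u\<leftarrow>us. bil J y u u)" if "(y, r) \<in> R" for y r
  proof (rule antisym)
    have neg: "bil J (\<lambda>i j. - 1 * y i j) u u = - bil J y u u" for u
      using bil_scale_form[of J "-1" y u u] by simp
    have "(\<Sum>u\<leftarrow>us. - bil J y u u) \<le> - 1 * r"
      using ge[OF R_scale[OF that, of "-1"]] unfolding neg .
    moreover have "(\<Sum>u\<leftarrow>us. - bil J y u u) = - (\<Sum>u\<leftarrow>us. bil J y u u)"
      by (induction us) auto
    ultimately show "r \<le> (\<Sum>u\<leftarrow>us. bil J y u u)" by simp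
  qed (rule ge[OF that])
  with us show ?thesis by blast
qed

section \<open>Duality for cones generated by the values of a quadratic form\<close>

lemma linear_functional_off_subspace:
  fixes p :: "'a::real_vector"
  assumes "subspace V" "p \<notin> V"
  obtains h :: "'a \<Rightarrow> real" where "linear h" "\<And>v. v \<in> V \<Longrightarrow> h v = 0" "h p = 1"
proof -
  obtain B where B: "B \<subseteq> V" "independent B" "V \<subseteq> span B"
    using maximal_independent_subset by blast
  have "span B = V" using B assms(1) by (simp add: span_minimal subset_antisym)
  then have "independent (insert p B)" using B assms(2) by (simp add: independent_insert)
  then obtain h :: "'a \<Rightarrow> real" where h: "linear h" "\<And>x. x \<in> insert p B \<Longrightarrow> h x = (if x = p then 1 else 0)"
    using linear_independent_extend[of "insert p B" "\<lambda>x. if x = p then 1 else (0::real)"] by blast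
  have "h v = 0" if "v \<in> V" for v
  proof (rule linear_eq_0_on_span[OF h(1)])
    show "v \<in> span B" using that B by blast
    show "h x = 0" if "x \<in> B" for x using h(2)[of x] that B assms(2) by auto
  qed
  then show ?thesis using h(1) h(2)[of p] by (intro that[of h]) auto
qed

text \<open>
  The difference of the vectors lies in the kernel of the form modulo \<open>V\<close>, so all mixed terms do too.
\<close>

lemma bil_diff_congruent:
  assumes sym: "\<And>i j. i \<in> I \<Longrightarrow> j \<in> I \<Longrightarrow> B i j = B j i"
    and "subspace V" and K: "\<And>w. bil I B w (\<lambda>i. u i - v i) \<in> V"
  shows "bil I B u u - bil I B v v \<in> V"
proof -
  let ?k = "\<lambda>i. u i - v i"
  have u: "u = (\<lambda>i. v i + ?k i)" by auto
  have "bil I B u u = bil I B v v + bil I B v ?k + (bil I B ?k v + bil I B ?k ?k)"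
    by (subst (1 2) u) (simp only: bil_add_left bil_add_right add_ac)
  moreover have "bil I B ?k v = bil I B v ?k" by (rule bil_commute[OF sym])
  ultimately have "bil I B u u - bil I B v v = bil I B v ?k + (bil I B v ?k + bil I B ?k ?k)"
    by simp
  then show ?thesis using K assms(2) by (metis subspace_add)
qed

text \<open>
  Exact duality without closure, for the cone of sums of values \<open>bil I B u u\<close> modulo \<open>V\<close>. By \<open>face\<close>,
  values that sum to zero modulo \<open>V\<close> are all zero modulo \<open>V\<close>; by \<open>kernel\<close>, vectors that are isotropic
  modulo \<open>V\<close> are in the radical. Let \<open>J\<close> be a minimal set of coordinates such that every vector is congruent, modulo the
  radical, to one supported in \<open>J\<close>; then no nonzero vector supported in \<open>J\<close> is isotropic.

  First, some functional \<open>g\<close> vanishing on \<open>V\<close> makes the form positive definite on \<open>J\<close>. Otherwise the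
  functional that reads off \<open>t\<close> from \<open>t E + h B\<close>, with the identity matrix \<open>E\<close>, would be nonnegative on positive semidefinite matrices,
  hence a sum of squares over vectors \<open>u\<close> whose total \<open>bil I B u u\<close> is annihilated by all \<open>h\<close> and so lies
  in \<open>V\<close>. Then every such \<open>u\<close> is isotropic, thus zero, although the functional is 1 at \<open>E\<close>.

  Second, if no separating functional exists, sending \<open>h B\<close> to \<open>h f\<close> is nonnegative on positive
  semidefinite matrices, and \<open>g B\<close> is positive definite. So this functional is a sum of squares too, which
  represents \<open>f\<close> modulo \<open>V\<close>.
\<close>

theorem quadratic_values_alternative:
  fixes B :: "nat \<Rightarrow> nat \<Rightarrow> 'a::real_vector"
  assumes "finite I"
    and sym: "\<And>i j. i \<in> I \<Longrightarrow> j \<in> I \<Longrightarrow> B i j = B j i"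
    and V: "subspace V"
    and face: "\<And>us u. (\<Sum>u\<leftarrow>us. bil I B u u) \<in> V \<Longrightarrow> u \<in> set us \<Longrightarrow> bil I B u u \<in> V"
    and kernel: "\<And>u w. bil I B u u \<in> V \<Longrightarrow> bil I B w u \<in> V"
  shows "(\<exists>us. f - (\<Sum>u\<leftarrow>us. bil I B u u) \<in> V) \<or>
    (\<exists>h :: 'a \<Rightarrow> real. linear h \<and> (\<forall>v\<in>V. h v = 0) \<and> (\<forall>u. 0 \<le> h (bil I B u u)) \<and> h f < 0)"
proof -
  define good where "good J \<longleftrightarrow> J \<subseteq> I \<and>
    (\<forall>u. \<exists>v. supported J v \<and> (\<forall>w. bil I B w (\<lambda>i. u i - v i) \<in> V))" for J
  have "good I"
    unfolding good_def
  proof (intro conjI allI exI)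
    fix u w
    show "supported I (\<lambda>i. if i \<in> I then u i else 0)" by (simp add: supported_def)
    have "bil I B w (\<lambda>i. u i - (if i \<in> I then u i else 0)) = bil I B w (\<lambda>_. 0)"
      by (rule bil_cong) auto
    then show "bil I B w (\<lambda>i. u i - (if i \<in> I then u i else 0)) \<in> V"
      using V by (simp add: bil_def subspace_0)
  qed simp
  then obtain J where good: "good J" and min: "\<And>J'. good J' \<Longrightarrow> card J \<le> card J'"
    using ex_has_least_nat[of good I card] by blast
  have J: "J \<subseteq> I" "finite J" using good \<open>finite I\<close> finite_subset by (auto simp: good_def)
  define F where "F = {h :: 'a \<Rightarrow> real. linear h \<and> (\<forall>v\<in>V. h v = 0)}"
  have F_zero: "(\<lambda>_. 0) \<in> F" by (simp add: F_def linear_iff)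
  have F_add: "(\<lambda>x. h x + g x) \<in> F" if "h \<in> F" "g \<in> F" for h g
    using that by (auto simp: F_def linear_iff algebra_simps)
  have F_scale: "(\<lambda>x. t * h x) \<in> F" if "h \<in> F" for h t
    using that by (auto simp: F_def linear_iff algebra_simps)
  have F_sep: "p \<in> V" if "\<And>h. h \<in> F \<Longrightarrow> h p = 0" for p
  proof (rule ccontr)
    assume "p \<notin> V"
    then obtain h :: "'a \<Rightarrow> real" where "linear h" "\<And>v. v \<in> V \<Longrightarrow> h v = 0" "h p = 1"
      by (rule linear_functional_off_subspace[OF V]) blast
    then show False using that[of h] by (simp add: F_def)
  qed
  have F_bil: "h (bil I B u u) = bil J (\<lambda>i j. h (B i j)) u u" if "h \<in> F" "supported J u" for h u
    using bil_linear[of h I B u u] bil_restrict[OF \<open>finite I\<close> J(1) that(2) that(2)] that(1)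
    by (simp add: F_def)
  have F_sum: "h (\<Sum>u\<leftarrow>us. bil I B u u) = (\<Sum>u\<leftarrow>us. bil J (\<lambda>i j. h (B i j)) u u)"
    if "h \<in> F" "\<And>u. u \<in> set us \<Longrightarrow> supported J u" for h us
    using that(2)
  proof (induction us)
    case Nil
    then show ?case using that(1) by (simp add: F_def linear_0)
  next
    case (Cons u us)
    then show ?case using that(1) by (simp add: F_def linear_add F_bil[OF that(1)])
  qed
  have F_nonneg: "0 \<le> h (bil I B u u)"
    if h: "h \<in> F" and nonneg: "\<And>u. supported J u \<Longrightarrow> 0 \<le> bil J (\<lambda>i j. h (B i j)) u u" for h u
  proof -
    obtain v where v: "supported J v" "\<And>w. bil I B w (\<lambda>i. u i - v i) \<in> V"
      using good unfolding good_def by blast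
    have "bil I B u u - bil I B v v \<in> V" by (rule bil_diff_congruent[OF sym V v(2)])
    then have "h (bil I B u u) = h (bil I B v v)"
      using h linear_diff[of h "bil I B u u" "bil I B v v"] by (auto simp: F_def)
    then show ?thesis using nonneg[OF v(1)] F_bil[OF h v(1)] by simp
  qed
  have no_kernel: "u i = 0" if u: "supported J u" "bil I B u u \<in> V" and "i \<in> J" for u i
  proof (rule ccontr)
    assume nz: "u i \<noteq> 0"
    have "good (J - {i})"
      unfolding good_def
    proof (intro conjI allI)
      fix w
      obtain v where v: "supported J v" "\<And>x. bil I B x (\<lambda>i. w i - v i) \<in> V"
        using good unfolding good_def by blast
      \<comment> \<open>Subtracting a multiple of the isotropic u from v clears the entry at i, so i can be dropped.\<close>
      define c where "c = - (v i / u i)"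
      define v' where "v' = (\<lambda>j. v j + c * u j)"
      have "supported (J - {i}) v'" using v(1) u(1) nz by (auto simp: supported_def v'_def c_def)
      moreover have "bil I B x (\<lambda>i. w i - v' i) \<in> V" for x
      proof -
        have "bil I B x (\<lambda>i. w i - v' i) = bil I B x (\<lambda>i. (w i - v i) + - c * u i)"
          by (rule bil_cong) (auto simp: v'_def)
        also have "\<dots> = bil I B x (\<lambda>i. w i - v i) + - c *\<^sub>R bil I B x u"
          by (simp only: bil_add_right bil_scale_right)
        also have "\<dots> \<in> V" using V v(2) kernel[OF u(2)] by (metis subspace_add subspace_scale)
        finally show ?thesis .
      qed
      ultimately show "\<exists>v. supported (J - {i}) v \<and> (\<forall>x. bil I B x (\<lambda>i. w i - v i) \<in> V)" by blast
    qed (use J in auto)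
    then have "card J \<le> card (J - {i})" by (rule min)
    then show False using \<open>i \<in> J\<close> \<open>finite J\<close> by (metis card_Diff1_less leD)
  qed
  have "\<exists>h\<in>F. \<forall>u. supported J u \<longrightarrow> (\<Sum>i\<in>J. (u i)\<^sup>2) \<le> bil J (\<lambda>i j. h (B i j)) u u"
  proof (rule ccontr)
    assume none: "\<not> ?thesis"
    define R where "R = {(\<lambda>i j. (if i = j then t else 0) + h (B i j), t) |t h. h \<in> F}"
    have ident: "bil J (\<lambda>i j. (if i = j then t else 0) + C i j) u u = t * (\<Sum>i\<in>J. (u i)\<^sup>2) + bil J C u u"
      for t u and C :: "nat \<Rightarrow> nat \<Rightarrow> real"
    proof -
      have "bil J (\<lambda>i j. if i = j then t else 0) u u = (\<Sum>i\<in>J. \<Sum>j\<in>J. if i = j then t * (u i)\<^sup>2 else 0)"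
        unfolding bil_def by (intro sum.cong refl) (auto simp: power2_eq_square)
      also have "\<dots> = (\<Sum>i\<in>J. t * (u i)\<^sup>2)" using J by simp
      finally show ?thesis by (simp add: bil_add_form sum_distrib_left)
    qed
    have "\<exists>us. (\<forall>u\<in>set us. supported J u) \<and> (\<forall>(y, r)\<in>R. r = (\<Sum>u\<leftarrow>us. bil J y u u))"
    proof (rule psd_positive_functional_sos[OF \<open>finite J\<close>])
      fix y r z s assume "(y, r) \<in> R" "(z, s) \<in> R"
      then obtain h g where hg: "h \<in> F" "g \<in> F" "y = (\<lambda>i j. (if i = j then r else 0) + h (B i j))"
        "z = (\<lambda>i j. (if i = j then s else 0) + g (B i j))" by (auto simp: R_def)
      show "(\<lambda>i j. y i j + z i j, r + s) \<in> R"
        unfolding R_def hg by (intro CollectI exI[of _ "r + s"] exI[of _ "\<lambda>x. h x + g x"] conjI F_add hg) (auto simp: fun_eq_iff)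
    next
      fix y r t assume "(y, r) \<in> R"
      then obtain h where h: "h \<in> F" "y = (\<lambda>i j. (if i = j then r else 0) + h (B i j))"
        by (auto simp: R_def)
      show "(\<lambda>i j. t * y i j, t * r) \<in> R"
        unfolding R_def h by (intro CollectI exI[of _ "t * r"] exI[of _ "\<lambda>x. t * h x"] conjI F_scale h) (auto simp: fun_eq_iff algebra_simps)
    next
      fix y r assume "(y, r) \<in> R" and psd: "\<And>u. supported J u \<Longrightarrow> 0 \<le> bil J y u u"
      then obtain h where h: "h \<in> F" "y = (\<lambda>i j. (if i = j then r else 0) + h (B i j))"
        by (auto simp: R_def)
      show "0 \<le> r"
      proof (rule ccontr)
        assume "\<not> 0 \<le> r"
        then have "r < 0" by simp
        have "(\<Sum>i\<in>J. (u i)\<^sup>2) \<le> bil J (\<lambda>i j. (- 1 / r) * h (B i j)) u u" if "supported J u" for u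
        proof -
          have "(\<Sum>i\<in>J. (u i)\<^sup>2) * - r \<le> bil J (\<lambda>i j. h (B i j)) u u"
            using psd[OF that] unfolding h ident by (simp add: mult.commute)
          then have "(\<Sum>i\<in>J. (u i)\<^sup>2) \<le> bil J (\<lambda>i j. h (B i j)) u u / - r"
            using \<open>r < 0\<close> by (subst pos_le_divide_eq) auto
          also have "\<dots> = bil J (\<lambda>i j. (- 1 / r) * h (B i j)) u u"
            using bil_scale_form[of J "- 1 / r" "\<lambda>i j. h (B i j)" u u] by simp
          finally show ?thesis .
        qed
        with F_scale[OF h(1), of "- 1 / r"] none show False
          by (auto dest!: bspec[of _ _ "\<lambda>x. (- 1 / r) * h x"])
      qed
    next
      show "(\<lambda>i j. if i = j then 1 else 0, 1) \<in> R"
        unfolding R_def by (intro CollectI exI[of _ "1::real"] exI[of _ "\<lambda>_. 0"]) (simp add: F_zero)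
    next
      fix u show "(\<Sum>i\<in>J. (u i)\<^sup>2) \<le> bil J (\<lambda>i j. if i = j then 1 else 0) u u"
        using ident[of 1 "\<lambda>_ _. 0" u] by (simp add: bil_def)
    qed
    then obtain us where us: "\<And>u. u \<in> set us \<Longrightarrow> supported J u"
      and R_us: "\<And>y r. (y, r) \<in> R \<Longrightarrow> r = (\<Sum>u\<leftarrow>us. bil J y u u)" by blast
    have "(\<Sum>u\<leftarrow>us. bil I B u u) \<in> V"
    proof (rule F_sep)
      fix h assume h: "h \<in> F"
      have "(\<lambda>i j. h (B i j), 0) \<in> R"
        unfolding R_def using h by (intro CollectI exI[of _ "0::real"] exI[of _ h]) (auto simp: fun_eq_iff)
      from R_us[OF this] show "h (\<Sum>u\<leftarrow>us. bil I B u u) = 0" using F_sum[OF h us] by simp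
    qed
    then have "bil I B u u \<in> V" if "u \<in> set us" for u using face that by blast
    then have zero: "u i = 0" if "u \<in> set us" "i \<in> J" for u i using no_kernel us that by blast
    have "(\<lambda>i j. if i = j then 1 else 0, 1) \<in> R"
      unfolding R_def by (intro CollectI exI[of _ "1::real"] exI[of _ "\<lambda>_. 0"]) (simp add: F_zero)
    from R_us[OF this] have "(1::real) = (\<Sum>u\<leftarrow>us. bil J (\<lambda>i j. if i = j then 1 else 0) u u)" .
    also have "\<dots> = (0::real)"
      by (rule sum_list_map_eq_zero) (auto simp: bil_def zero intro!: sum.neutral)
    finally show False by simp
  qed
  then obtain g where g: "g \<in> F"
    "\<And>u. supported J u \<Longrightarrow> (\<Sum>i\<in>J. (u i)\<^sup>2) \<le> bil J (\<lambda>i j. g (B i j)) u u" by blast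
  show ?thesis
  proof (rule disjCI)
    assume no: "\<not> (\<exists>h :: 'a \<Rightarrow> real. linear h \<and> (\<forall>v\<in>V. h v = 0) \<and> (\<forall>u. 0 \<le> h (bil I B u u)) \<and> h f < 0)"
    have f_nonneg: "0 \<le> h f" if "h \<in> F" "\<And>u. 0 \<le> h (bil I B u u)" for h
      using no that unfolding F_def by (metis (mono_tags, lifting) mem_Collect_eq not_le)
    define R where "R = {(\<lambda>i j. h (B i j), h f) |h. h \<in> F}"
    have "\<exists>us. (\<forall>u\<in>set us. supported J u) \<and> (\<forall>(y, r)\<in>R. r = (\<Sum>u\<leftarrow>us. bil J y u u))"
    proof (rule psd_positive_functional_sos[OF \<open>finite J\<close>])
      fix y r z s assume "(y, r) \<in> R" "(z, s) \<in> R"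
      then obtain h g where hg: "h \<in> F" "g \<in> F" "y = (\<lambda>i j. h (B i j))" "r = h f"
        "z = (\<lambda>i j. g (B i j))" "s = g f" by (auto simp: R_def)
      show "(\<lambda>i j. y i j + z i j, r + s) \<in> R"
        unfolding R_def hg(3-6) by (intro CollectI exI[of _ "\<lambda>x. h x + g x"] conjI F_add hg) simp
    next
      fix y r t assume "(y, r) \<in> R"
      then obtain h where h: "h \<in> F" "y = (\<lambda>i j. h (B i j))" "r = h f" by (auto simp: R_def)
      show "(\<lambda>i j. t * y i j, t * r) \<in> R"
        unfolding R_def h(2,3) by (intro CollectI exI[of _ "\<lambda>x. t * h x"] conjI F_scale h) simp
    next
      fix y r assume "(y, r) \<in> R" and psd: "\<And>u. supported J u \<Longrightarrow> 0 \<le> bil J y u u"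
      then obtain h where h: "h \<in> F" "y = (\<lambda>i j. h (B i j))" "r = h f" by (auto simp: R_def)
      show "0 \<le> r"
        unfolding h(3) by (rule f_nonneg[OF h(1) F_nonneg[OF h(1) psd[unfolded h(2)]]])
    next
      show "(\<lambda>i j. g (B i j), g f) \<in> R" using g by (auto simp: R_def)
    qed (rule g(2))
    then obtain us where us: "\<And>u. u \<in> set us \<Longrightarrow> supported J u"
      and R_us: "\<And>y r. (y, r) \<in> R \<Longrightarrow> r = (\<Sum>u\<leftarrow>us. bil J y u u)" by blast
    have "f - (\<Sum>u\<leftarrow>us. bil I B u u) \<in> V"
    proof (rule F_sep)
      fix h assume h: "h \<in> F"
      have "h f = (\<Sum>u\<leftarrow>us. bil J (\<lambda>i j. h (B i j)) u u)" using h by (intro R_us) (auto simp: R_def)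
      then show "h (f - (\<Sum>u\<leftarrow>us. bil I B u u)) = 0"
        using h F_sum[OF h us] by (simp add: F_def linear_diff)
    qed
    then show "\<exists>us. f - (\<Sum>u\<leftarrow>us. bil I B u u) \<in> V" by blast
  qed
qed

section \<open>Polynomials as a real algebra and their values\<close>

text \<open>
  Scalar multiplication makes linear functionals, spans and independence of the library available for
  spaces of polynomials.
\<close>

instantiation poly_mapping :: (type, real_vector) real_vector
begin

lift_definition scaleR_poly_mapping :: "real \<Rightarrow> ('a \<Rightarrow>\<^sub>0 'b) \<Rightarrow> 'a \<Rightarrow>\<^sub>0 'b"
  is "\<lambda>r f k. r *\<^sub>R f k"
  by (rule rev_finite_subset) auto

instance
  by standard (transfer; simp add: fun_eq_iff algebra_simps)+

end

lemma lookup_scaleR [simp]: "Poly_Mapping.lookup (r *\<^sub>R p) k = r *\<^sub>R Poly_Mapping.lookup p k"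
  by transfer simp

lemma scaleR_eq_single_mult:
  fixes p :: "'a::comm_monoid_add \<Rightarrow>\<^sub>0 'b::{real_algebra_1, comm_ring_1}"
  shows "r *\<^sub>R p = Poly_Mapping.single 0 (of_real r) * p"
  unfolding mult_map_scale_conv_mult[symmetric]
  by (rule poly_mapping_eqI) (simp add: Poly_Mapping.map.rep_eq when_def scaleR_conv_of_real)

instance poly_mapping :: (comm_monoid_add, "{real_algebra_1, comm_ring_1}") real_algebra_1
  by standard (simp_all add: scaleR_eq_single_mult mult_ac)

lemma Const_eq_of_real: "Const r = of_real r"
proof -
  have "(of_real r :: rpoly) = r *\<^sub>R 1" by (simp add: of_real_def)
  also have "\<dots> = Const r" unfolding scaleR_eq_single_mult Const_def by simp
  finally show ?thesis by simp
qed

definition mons_le :: "nat \<Rightarrow> nat \<Rightarrow> monomial set"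
  where "mons_le n k = {a \<in> monomials_in n. mdeg a \<le> k}"

abbreviation as_poly :: "monomial \<Rightarrow> rpoly" where "as_poly a \<equiv> Poly_Mapping.single a 1"

lemma polys_deg_le_iff: "p \<in> polys_deg_le n k \<longleftrightarrow> Poly_Mapping.keys p \<subseteq> mons_le n k"
  by (auto simp: polys_deg_le_def polys_in_def mons_le_def)

lemma subspace_polys_deg_le: "subspace (polys_deg_le n k)"
proof (rule subspaceI)
  show "0 \<in> polys_deg_le n k" by (simp add: polys_deg_le_iff)
  show "p + q \<in> polys_deg_le n k" if "p \<in> polys_deg_le n k" "q \<in> polys_deg_le n k" for p q
    using that keys_add[of p q] unfolding polys_deg_le_iff by blast
  show "r *\<^sub>R p \<in> polys_deg_le n k" if "p \<in> polys_deg_le n k" for r p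
  proof -
    have "Poly_Mapping.keys (r *\<^sub>R p) \<subseteq> Poly_Mapping.keys p" by (auto simp: in_keys_iff)
    then show ?thesis using that unfolding polys_deg_le_iff by blast
  qed
qed

lemma mdeg_add:
  assumes "a \<in> monomials_in n" "b \<in> monomials_in n"
  shows "a + b \<in> monomials_in n" "mdeg (a + b) = mdeg a + mdeg b"
proof -
  show "a + b \<in> monomials_in n" using assms keys_add[of a b] by (auto simp: monomials_in_def)
  then show "mdeg (a + b) = mdeg a + mdeg b"
    using assms by (simp add: mdeg_eq_sum lookup_add sum.distrib)
qed

lemma polys_deg_le_mult:
  assumes "p \<in> polys_deg_le n k" "q \<in> polys_deg_le n l"
  shows "p * q \<in> polys_deg_le n (k + l)"
  unfolding polys_deg_le_iff
proof
  fix c assume "c \<in> Poly_Mapping.keys (p * q)"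
  then obtain a b where "c = a + b" "a \<in> mons_le n k" "b \<in> mons_le n l"
    using keys_mult[of p q] assms unfolding polys_deg_le_iff by blast
  then show "c \<in> mons_le n (k + l)"
    using mdeg_add[of a n b] by (simp add: mons_le_def)
qed

lemma polys_deg_le_mono: "p \<in> polys_deg_le n k \<Longrightarrow> k \<le> l \<Longrightarrow> p \<in> polys_deg_le n l"
  by (auto simp: polys_deg_le_iff mons_le_def)

lemma one_in_polys_deg_le: "1 \<in> polys_deg_le n k"
  by (auto simp: polys_deg_le_iff mons_le_def monomials_in_def mdeg_def)

lemma Const_in_polys_deg_le: "Const r \<in> polys_deg_le n k"
  using subspace_scale[OF subspace_polys_deg_le one_in_polys_deg_le, of r n k]
  by (simp add: Const_eq_of_real of_real_def)

lemma poly_expansion: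
  fixes p :: rpoly
  assumes "finite K" "Poly_Mapping.keys p \<subseteq> K"
  shows "p = (\<Sum>a\<in>K. Poly_Mapping.lookup p a *\<^sub>R as_poly a)"
proof (rule poly_mapping_eqI)
  fix b
  have "Poly_Mapping.lookup (\<Sum>a\<in>K. Poly_Mapping.lookup p a *\<^sub>R as_poly a) b =
      (\<Sum>a\<in>K. if a = b then Poly_Mapping.lookup p a else 0)"
    unfolding lookup_sum by (rule sum.cong) (auto simp: lookup_single when_def)
  also have "\<dots> = Poly_Mapping.lookup p b" using assms by (auto simp: in_keys_iff)
  finally show "Poly_Mapping.lookup p b = Poly_Mapping.lookup (\<Sum>a\<in>K. Poly_Mapping.lookup p a *\<^sub>R as_poly a) b"
    by simp
qed

lemma poly_in_span_mono: "Poly_Mapping.keys p \<subseteq> K \<Longrightarrow> p \<in> span (as_poly ` K)"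
proof -
  assume "Poly_Mapping.keys p \<subseteq> K"
  then have "(\<Sum>a\<in>Poly_Mapping.keys p. Poly_Mapping.lookup p a *\<^sub>R as_poly a) \<in> span (as_poly ` K)"
    by (intro span_sum span_scale span_base) auto
  then show ?thesis using poly_expansion[of "Poly_Mapping.keys p" p] by simp
qed

definition mono_eval :: "real vec \<Rightarrow> monomial \<Rightarrow> real" where
  "mono_eval x a = (\<Prod>i\<in>Poly_Mapping.keys a. vec_index x i ^ Poly_Mapping.lookup a i)"

lemma poly_eval_superset:
  assumes "finite K" "Poly_Mapping.keys p \<subseteq> K"
  shows "poly_eval x p = (\<Sum>a\<in>K. Poly_Mapping.lookup p a * mono_eval x a)"
  unfolding poly_eval_def mono_eval_def using assms
  by (intro sum.mono_neutral_left) (auto simp: in_keys_iff)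

lemma linear_poly_eval: "linear (poly_eval x)"
proof (rule linearI)
  fix p q :: rpoly
  let ?K = "Poly_Mapping.keys p \<union> Poly_Mapping.keys q"
  have "finite ?K" "Poly_Mapping.keys (p + q) \<subseteq> ?K" using keys_add[of p q] by auto
  then show "poly_eval x (p + q) = poly_eval x p + poly_eval x q"
    by (simp add: poly_eval_superset[of ?K] lookup_add algebra_simps sum.distrib)
next
  fix r and p :: rpoly
  let ?K = "Poly_Mapping.keys p"
  have "Poly_Mapping.keys (r *\<^sub>R p) \<subseteq> ?K" by (auto simp: in_keys_iff)
  then show "poly_eval x (r *\<^sub>R p) = r *\<^sub>R poly_eval x p"
    by (simp add: poly_eval_superset[of ?K] sum_distrib_left mult.assoc)
qed

lemma poly_eval_mono: "poly_eval x (as_poly a) = mono_eval x a"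
  by (simp add: poly_eval_superset[of "{a}"])

lemma mono_eval_superset:
  assumes "finite K" "Poly_Mapping.keys a \<subseteq> K"
  shows "mono_eval x a = (\<Prod>i\<in>K. vec_index x i ^ Poly_Mapping.lookup a i)"
  unfolding mono_eval_def using assms
  by (intro prod.mono_neutral_left) (auto simp: in_keys_iff)

lemma mono_eval_add: "mono_eval x (a + b) = mono_eval x a * mono_eval x b"
proof -
  let ?K = "Poly_Mapping.keys a \<union> Poly_Mapping.keys b"
  have "finite ?K" "Poly_Mapping.keys (a + b) \<subseteq> ?K" using keys_add[of a b] by auto
  then show ?thesis
    by (simp add: mono_eval_superset[of ?K] lookup_add power_add prod.distrib)
qed

lemma poly_eval_mult: "poly_eval x (p * q) = poly_eval x p * poly_eval x q"
proof -
  let ?P = "Poly_Mapping.keys p" and ?Q = "Poly_Mapping.keys q"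
  have "p * q = (\<Sum>a\<in>?P. Poly_Mapping.lookup p a *\<^sub>R as_poly a) * (\<Sum>b\<in>?Q. Poly_Mapping.lookup q b *\<^sub>R as_poly b)"
    using poly_expansion[of ?P p] poly_expansion[of ?Q q] by simp
  also have "\<dots> = (\<Sum>a\<in>?P. \<Sum>b\<in>?Q. (Poly_Mapping.lookup p a * Poly_Mapping.lookup q b) *\<^sub>R as_poly (a + b))"
    by (simp add: sum_product mult_single mult.commute)
  finally have "poly_eval x (p * q) =
      (\<Sum>a\<in>?P. \<Sum>b\<in>?Q. (Poly_Mapping.lookup p a * Poly_Mapping.lookup q b) * (mono_eval x a * mono_eval x b))"
    by (simp add: linear_sum[OF linear_poly_eval] linear_scale[OF linear_poly_eval] poly_eval_mono mono_eval_add)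
  also have "\<dots> = poly_eval x p * poly_eval x q"
    by (simp add: poly_eval_superset[of ?P p] poly_eval_superset[of ?Q q] sum_product mult_ac)
  finally show ?thesis .
qed

lemma poly_eval_Const: "poly_eval x (Const r) = r"
  using linear_scale[OF linear_poly_eval, of x r 1]
  by (simp add: Const_eq_of_real of_real_def poly_eval_mono[of x 0, simplified] mono_eval_def)

lemma mons_le_1: "mons_le n 1 = insert 0 ((\<lambda>i. Poly_Mapping.single i 1) ` {..<n})"
  using set_monomial_list[of n 1] unfolding monomial_list_1 mons_le_def by auto

text \<open>
  This turns separating functionals into points.
\<close>

lemma linear_functional_eq_poly_eval:
  assumes "linear h" "h 1 = 1" "p \<in> polys_deg_le n 1"
  shows "h p = poly_eval (vec n (\<lambda>i. h (as_poly (Poly_Mapping.single i 1)))) p" (is "_ = poly_eval ?x p")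
proof (rule linear_eq_on[OF assms(1) linear_poly_eval])
  show "p \<in> span (as_poly ` mons_le n 1)" using assms(3) by (intro poly_in_span_mono) (simp add: polys_deg_le_iff)
  fix q assume "q \<in> as_poly ` mons_le n 1"
  then consider "q = 1" | i where "i < n" "q = as_poly (Poly_Mapping.single i 1)"
    unfolding mons_le_1 by auto
  then show "h q = poly_eval ?x q"
  proof cases
    case 1
    then show ?thesis using assms(2) poly_eval_mono[of ?x 0] by (simp add: mono_eval_def)
  next
    case 2
    then show ?thesis by (simp add: poly_eval_mono mono_eval_def)
  qed
qed

lemma distinct_monomial_list: "distinct (monomial_list n d)"
proof (induction d)
  case 0
  then show ?case by (simp add: monomial_list_def)
next
  case (Suc d)
  have "monomial_list n (Suc d) =
      monomial_list n d @ rev (sorted_list_of_set {a \<in> monomials_in n. mdeg a = Suc d})"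
    by (simp add: monomial_list_def)
  then show ?case
    using Suc set_monomial_list[of n d] by (auto simp: finite_monomials)
qed

section \<open>Gram polynomials\<close>

definition nth_mono :: "nat \<Rightarrow> nat \<Rightarrow> nat \<Rightarrow> rpoly"
  where "nth_mono n d k = as_poly (monomial_list n d ! k)"

lemma poly_expansion_nth_mono:
  assumes "p \<in> polys_deg_le n d"
  shows "p = (\<Sum>k<num_mons n d. Poly_Mapping.lookup p (monomial_list n d ! k) *\<^sub>R nth_mono n d k)"
proof -
  have bij: "bij_betw ((!) (monomial_list n d)) {..<num_mons n d} (mons_le n d)"
    using bij_betw_nth[OF distinct_monomial_list[of n d] refl refl]
    by (simp add: length_monomial_list set_monomial_list mons_le_def)
  have "finite (mons_le n d)" by (metis List.finite_set set_monomial_list mons_le_def)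
  then have "p = (\<Sum>a\<in>mons_le n d. Poly_Mapping.lookup p a *\<^sub>R as_poly a)"
    using assms by (intro poly_expansion) (simp_all add: polys_deg_le_iff)
  also have "\<dots> = (\<Sum>k<num_mons n d. Poly_Mapping.lookup p (monomial_list n d ! k) *\<^sub>R nth_mono n d k)"
    unfolding nth_mono_def by (rule sum.reindex_bij_betw[OF bij, symmetric])
  finally show ?thesis .
qed

lemma nth_mono_in_polys_deg_le: "k < num_mons n d \<Longrightarrow> nth_mono n d k \<in> polys_deg_le n d"
  using nth_mem[of k "monomial_list n d"] set_monomial_list[of n d]
  by (auto simp: nth_mono_def polys_deg_le_iff mons_le_def length_monomial_list)

text \<open>
  Row \<open>r\<close> of \<open>A\<close>, applied to the vector of monomials of degree at most \<open>e\<close>.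
\<close>

definition row_poly :: "nat \<Rightarrow> nat \<Rightarrow> real mat \<Rightarrow> nat \<Rightarrow> rpoly"
  where "row_poly n e A r = (\<Sum>k<num_mons n e. A $$ (r, k) *\<^sub>R nth_mono n e k)"

lemma gram_poly_eq:
  assumes "A \<in> carrier_mat (num_mons n d) (num_mons n e)"
  shows "gram_poly n d e A = (\<Sum>r<num_mons n d. nth_mono n d r * row_poly n e A r)"
proof -
  have index: "monomial_vec n d' $ k = nth_mono n d' k" if "k < num_mons n d'" for d' k
    using that by (simp add: monomial_vec_def nth_mono_def vec_of_list_index length_monomial_list)
  have "(map_mat Const A *\<^sub>v monomial_vec n e) $ r = row_poly n e A r" if "r < num_mons n d" for r
  proof -
    have "(map_mat Const A *\<^sub>v monomial_vec n e) $ r = (\<Sum>k<num_mons n e. map_mat Const A $$ (r, k) * monomial_vec n e $ k)"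
      using that assms monomial_vec_carrier[of n e]
      by (simp add: scalar_prod_def atLeast0LessThan)
    also have "\<dots> = row_poly n e A r"
      unfolding row_poly_def using that assms
      by (intro sum.cong) (auto simp: index Const_eq_of_real scaleR_conv_of_real)
    finally show ?thesis .
  qed
  then show ?thesis
    unfolding gram_poly_def using assms monomial_vec_carrier[of n d]
    by (simp add: scalar_prod_def atLeast0LessThan index)
qed

section \<open>Pencils, sos-matrices and spectrahedra\<close>

text \<open>
  The polynomial \<open>p\<^sup>* L p\<close>, for a vector \<open>p\<close> of \<open>m\<close> polynomials; sums of these are the traces of \<open>L S\<close>
  for sos-matrices \<open>S\<close>, a vector being a row of the factor of \<open>S\<close>.
\<close>

definition pquad :: "nat \<Rightarrow> rpoly mat \<Rightarrow> (nat \<Rightarrow> rpoly) \<Rightarrow> rpoly"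
  where "pquad m L p = (\<Sum>i<m. \<Sum>j<m. p i * p j * L $$ (i, j))"

abbreviation pencil_form :: "nat \<Rightarrow> rpoly mat \<Rightarrow> (nat \<Rightarrow> real) \<Rightarrow> (nat \<Rightarrow> real) \<Rightarrow> rpoly"
  where "pencil_form m L \<equiv> bil {..<m} (\<lambda>i j. L $$ (i, j))"

lemma sym_mat_index: "sym_mat m A \<Longrightarrow> i < m \<Longrightarrow> j < m \<Longrightarrow> A $$ (i, j) = A $$ (j, i)"
proof -
  assume *: "sym_mat m A" "i < m" "j < m"
  then have "transpose_mat A $$ (i, j) = A $$ (j, i)"
    by (subst index_transpose_mat(1)) (auto simp: sym_mat_def)
  with * show ?thesis by (simp add: sym_mat_def)
qed

lemma pencil_form_commute:
  assumes "sym_mat m L"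
  shows "pencil_form m L u w = pencil_form m L w u"
  using sym_mat_index[OF assms] by (intro bil_commute) auto

lemma pquad_constant_directions:
  assumes "sym_mat m L"
  shows "pquad m L (\<lambda>i. p * Const (u i) + q * Const (w i)) =
    p * p * pencil_form m L u u + 2 * p * q * pencil_form m L u w + q * q * pencil_form m L w w"
proof -
  have form: "(\<Sum>i<m. \<Sum>j<m. Const (a i) * Const (b j) * L $$ (i, j)) = pencil_form m L a b" for a b
    by (simp add: bil_def Const_eq_of_real scaleR_conv_of_real)
  have "pquad m L (\<lambda>i. p * Const (u i) + q * Const (w i)) =
      p * p * (\<Sum>i<m. \<Sum>j<m. Const (u i) * Const (u j) * L $$ (i, j)) +
      p * q * (\<Sum>i<m. \<Sum>j<m. Const (u i) * Const (w j) * L $$ (i, j)) +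
      p * q * (\<Sum>i<m. \<Sum>j<m. Const (w i) * Const (u j) * L $$ (i, j)) +
      q * q * (\<Sum>i<m. \<Sum>j<m. Const (w i) * Const (w j) * L $$ (i, j))"
    by (simp add: pquad_def algebra_simps sum.distrib sum_distrib_left)
  then show ?thesis
    unfolding form pencil_form_commute[OF assms, of w u] by (simp add: algebra_simps)
qed

lemma pquad_scaled_vector:
  assumes "sym_mat m L"
  shows "pquad m L (\<lambda>i. p * Const (u i)) = p * p * pencil_form m L u u"
  using pquad_constant_directions[OF assms, of p u 0 "\<lambda>_. 0"] by simp

lemma pquad_scale: "pquad m L (\<lambda>i. c *\<^sub>R p i) = (c * c) *\<^sub>R pquad m L p"
  unfolding pquad_def scaleR_sum_right by (intro sum.cong refl) simp

lemma poly_eval_pquad: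
  "poly_eval x (pquad m L p) =
    bil {..<m} (\<lambda>i j. poly_eval x (L $$ (i, j))) (\<lambda>i. poly_eval x (p i)) (\<lambda>i. poly_eval x (p i))"
  unfolding pquad_def bil_def
  by (simp only: linear_sum[OF linear_poly_eval] poly_eval_mult real_scaleR_def)

lemma pencil_form_in_polys_deg_le:
  assumes "linear_pencil n m L"
  shows "pencil_form m L u w \<in> polys_deg_le n 1"
proof -
  have "L $$ (i, j) \<in> polys_deg_le n 1" if "i < m" "j < m" for i j
    using that assms elements_matI[of L m m i j] by (auto simp: linear_pencil_def sym_mat_def)
  then show ?thesis
    unfolding bil_def
    by (intro subspace_sum[OF subspace_polys_deg_le] subspace_scale[OF subspace_polys_deg_le]) simp
qed

lemma mtrace_mult_transpose_mult:
  assumes "L \<in> carrier_mat m m" "P \<in> carrier_mat r m"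
  shows "mtrace (L * (transpose_mat P * P)) = (\<Sum>k<r. pquad m L (\<lambda>i. P $$ (k, i)))"
proof -
  have "mtrace (L * (transpose_mat P * P)) =
      (\<Sum>i<m. \<Sum>j<m. L $$ (i, j) * (\<Sum>k<r. P $$ (k, j) * P $$ (k, i)))"
    using assms unfolding mtrace_def
    by (auto simp: scalar_prod_def atLeast0LessThan intro!: sum.cong)
  also have "\<dots> = (\<Sum>i<m. \<Sum>j<m. \<Sum>k<r. P $$ (k, i) * P $$ (k, j) * L $$ (i, j))"
    by (simp add: sum_distrib_left mult_ac)
  also have "\<dots> = (\<Sum>i<m. \<Sum>k<r. \<Sum>j<m. P $$ (k, i) * P $$ (k, j) * L $$ (i, j))"
    by (intro sum.cong refl sum.swap)
  also have "\<dots> = (\<Sum>k<r. \<Sum>i<m. \<Sum>j<m. P $$ (k, i) * P $$ (k, j) * L $$ (i, j))"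
    by (rule sum.swap)
  finally show ?thesis by (simp add: pquad_def)
qed

lemma quadratic_sos_of_list:
  assumes "L \<in> carrier_mat m m" "\<And>p i. p \<in> set ps \<Longrightarrow> p i \<in> polys_deg_le n 1"
  shows "\<exists>S. quadratic_sos_mat n m S \<and> mtrace (L * S) = (\<Sum>p\<leftarrow>ps. pquad m L p)"
proof -
  define P where "P = mat (length ps) m (\<lambda>(k, i). (ps ! k) i)"
  have P: "P \<in> carrier_mat (length ps) m" by (simp add: P_def)
  have entry: "P $$ (k, i) \<in> polys_deg_le n 1" if "k < length ps" "i < m" for k i
    using that assms(2)[of "ps ! k"] by (simp add: P_def)
  have "elements_mat P \<subseteq> polys_in n"
    using P entry by (force simp: polys_deg_le_def dest!: elements_matD)
  then have "sos_mat n m (transpose_mat P * P)" unfolding sos_mat_def using P by blast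
  moreover have "elements_mat (transpose_mat P * P) \<subseteq> polys_deg_le n 2"
  proof
    fix q assume "q \<in> elements_mat (transpose_mat P * P)"
    then obtain i j where ij: "i < m" "j < m" "q = (transpose_mat P * P) $$ (i, j)"
      using P by (auto dest!: elements_matD)
    have "q = (\<Sum>k<length ps. P $$ (k, i) * P $$ (k, j))"
      using ij P by (auto simp: scalar_prod_def atLeast0LessThan intro!: sum.cong)
    also have "\<dots> \<in> polys_deg_le n (1 + 1)"
      using ij by (intro subspace_sum[OF subspace_polys_deg_le] polys_deg_le_mult entry) auto
    finally show "q \<in> polys_deg_le n 2" by (simp add: numeral_2_eq_2)
  qed
  moreover have "mtrace (L * (transpose_mat P * P)) = (\<Sum>p\<leftarrow>ps. pquad m L p)"
  proof -
    have "(\<Sum>k<length ps. pquad m L (\<lambda>i. P $$ (k, i))) = (\<Sum>k<length ps. pquad m L (ps ! k))"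
      by (intro sum.cong refl) (simp add: pquad_def P_def)
    then show ?thesis
      using mtrace_mult_transpose_mult[OF assms(1) P]
      by (simp add: sum_list_sum_nth atLeast0LessThan)
  qed
  ultimately show ?thesis unfolding quadratic_sos_mat_def by blast
qed

lemma psd_mat_iff_bil:
  "psd_mat m A \<longleftrightarrow> sym_mat m A \<and> (\<forall>u. 0 \<le> bil {..<m} (\<lambda>i j. A $$ (i, j)) u u)"
proof -
  have form: "v \<bullet> (A *\<^sub>v v) = bil {..<m} (\<lambda>i j. A $$ (i, j)) (vec_index v) (vec_index v)"
    if "A \<in> carrier_mat m m" "v \<in> carrier_vec m" for v
    using that by (simp add: bil_def scalar_prod_def atLeast0LessThan sum_distrib_left mult_ac)
  have cong: "bil {..<m} (\<lambda>i j. A $$ (i, j)) u u = bil {..<m} (\<lambda>i j. A $$ (i, j)) (vec_index (vec m u)) (vec_index (vec m u))" for u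
    by (rule bil_cong) auto
  show ?thesis
  proof (cases "sym_mat m A")
    case True
    then have A: "A \<in> carrier_mat m m" by (simp add: sym_mat_def)
    show ?thesis
      unfolding psd_mat_def using True form[OF A] cong by (metis vec_carrier)
  qed (simp add: psd_mat_def)
qed

lemma mtrace_mult_rank_one_sum:
  assumes "L \<in> carrier_mat m m" "S \<in> carrier_mat m m"
    and "\<And>i j. i < m \<Longrightarrow> j < m \<Longrightarrow> S $$ (i, j) = (\<Sum>u\<leftarrow>us. u i * u j)"
  shows "mtrace (L * map_mat Const S) = (\<Sum>u\<leftarrow>us. pencil_form m L u u)"
proof -
  have "mtrace (L * map_mat Const S) = (\<Sum>i<m. \<Sum>j<m. L $$ (i, j) * Const (S $$ (j, i)))"
    using assms(1,2) unfolding mtrace_def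
    by (auto simp: scalar_prod_def atLeast0LessThan intro!: sum.cong)
  also have "\<dots> = (\<Sum>i<m. \<Sum>j<m. (\<Sum>u\<leftarrow>us. u j * u i) *\<^sub>R L $$ (i, j))"
    by (intro sum.cong refl) (simp add: assms(3) Const_eq_of_real scaleR_conv_of_real mult.commute)
  also have "\<dots> = (\<Sum>u\<leftarrow>us. pencil_form m L u u)"
    by (induction us) (simp_all add: bil_def scaleR_left_distrib sum.distrib mult.commute)
  finally show ?thesis .
qed

lemma psd_mat_of_list:
  assumes "L \<in> carrier_mat m m"
  shows "\<exists>S. psd_mat m S \<and> mtrace (L * map_mat Const S) = (\<Sum>u\<leftarrow>us. pencil_form m L u u)"
proof -
  define S where "S = mat m m (\<lambda>(i, j). \<Sum>u\<leftarrow>us. u i * u j)"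
  have "sym_mat m S" unfolding sym_mat_def S_def by (auto simp: mult.commute)
  moreover have "0 \<le> bil {..<m} (\<lambda>i j. S $$ (i, j)) v v" for v
  proof -
    have "bil {..<m} (\<lambda>i j. S $$ (i, j)) v v = bil {..<m} (\<lambda>i j. \<Sum>u\<leftarrow>us. u i * u j) v v"
      by (rule bil_cong) (auto simp: S_def)
    also have "\<dots> = (\<Sum>u\<leftarrow>us. (\<Sum>i<m. v i * u i)\<^sup>2)"
    proof (induction us)
      case Nil
      then show ?case by (simp add: bil_def)
    next
      case (Cons u us)
      then show ?case by (simp add: bil_add_form bil_rank_one power2_eq_square)
    qed
    also have "\<dots> \<ge> 0" by (rule sum_list_nonneg) auto
    finally show ?thesis .
  qed
  ultimately have "psd_mat m S" by (simp add: psd_mat_iff_bil)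
  moreover have "mtrace (L * map_mat Const S) = (\<Sum>u\<leftarrow>us. pencil_form m L u u)"
    using assms by (rule mtrace_mult_rank_one_sum) (auto simp: S_def)
  ultimately show ?thesis by blast
qed

lemma psd_mat_decomposition:
  assumes "psd_mat m S"
  shows "\<exists>us. \<forall>i<m. \<forall>j<m. S $$ (i, j) = (\<Sum>u\<leftarrow>us. u i * u j)"
proof -
  have "S $$ (i, j) = S $$ (j, i)" if "i \<in> {..<m}" "j \<in> {..<m}" for i j
    using that assms sym_mat_index[of m S i j] by (simp add: psd_mat_def)
  moreover have "0 \<le> bil {..<m} (\<lambda>i j. S $$ (i, j)) u u" for u
    using assms by (simp add: psd_mat_iff_bil)
  ultimately have "\<exists>us. (\<forall>u\<in>set us. supported {..<m} u) \<and>
      (\<forall>i\<in>{..<m}. \<forall>j\<in>{..<m}. S $$ (i, j) = (\<Sum>u\<leftarrow>us. u i * u j))"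
    by (rule psd_sum_of_squares[OF finite_lessThan])
  then show ?thesis unfolding Ball_def lessThan_iff by blast
qed

lemma spectrahedron_iff:
  assumes "linear_pencil n m L"
  shows "x \<in> spectrahedron n m L \<longleftrightarrow> x \<in> carrier_vec n \<and> (\<forall>u. 0 \<le> poly_eval x (pencil_form m L u u))"
proof -
  have L: "L \<in> carrier_mat m m" "transpose_mat L = L" using assms by (auto simp: linear_pencil_def sym_mat_def)
  have "sym_mat m (map_mat (poly_eval x) L)"
    unfolding sym_mat_def using L(1) sym_mat_index[of m L] assms
    by (auto intro!: eq_matI simp: linear_pencil_def)
  moreover have "bil {..<m} (\<lambda>i j. map_mat (poly_eval x) L $$ (i, j)) u u = poly_eval x (pencil_form m L u u)" for u
    unfolding bil_linear[OF linear_poly_eval] using L by (intro bil_cong) auto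
  ultimately show ?thesis by (simp add: spectrahedron_def psd_mat_iff_bil)
qed

lemma poly_eval_pquad_nonneg:
  assumes "linear_pencil n m L" "x \<in> spectrahedron n m L"
  shows "0 \<le> poly_eval x (pquad m L p)"
proof -
  have "0 \<le> poly_eval x (pencil_form m L (\<lambda>i. poly_eval x (p i)) (\<lambda>i. poly_eval x (p i)))"
    using assms(2) unfolding spectrahedron_iff[OF assms(1)] by simp
  then show ?thesis unfolding poly_eval_pquad bil_linear[OF linear_poly_eval] .
qed

lemma poly_eval_mtrace_sos_nonneg:
  assumes "linear_pencil n m L" "x \<in> spectrahedron n m L" "sos_mat n m S"
  shows "0 \<le> poly_eval x (mtrace (L * S))"
proof -
  have L: "L \<in> carrier_mat m m" using assms(1) by (simp add: linear_pencil_def sym_mat_def)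
  obtain r P where P: "P \<in> carrier_mat r m" "S = transpose_mat P * P"
    using assms(3) by (auto simp: sos_mat_def)
  show ?thesis
    unfolding P(2) mtrace_mult_transpose_mult[OF L P(1)] linear_sum[OF linear_poly_eval]
    using poly_eval_pquad_nonneg[OF assms(1,2)] by (simp add: sum_nonneg)
qed

lemma poly_eval_mtrace_psd_nonneg:
  assumes "linear_pencil n m L" "x \<in> spectrahedron n m L" "psd_mat m S"
  shows "0 \<le> poly_eval x (mtrace (L * map_mat Const S))"
proof -
  have L: "L \<in> carrier_mat m m" using assms(1) by (simp add: linear_pencil_def sym_mat_def)
  have S: "S \<in> carrier_mat m m" using assms(3) by (simp add: psd_mat_def sym_mat_def)
  obtain us where us: "\<And>i j. i < m \<Longrightarrow> j < m \<Longrightarrow> S $$ (i, j) = (\<Sum>u\<leftarrow>us. u i * u j)"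
    using psd_mat_decomposition[OF assms(3)] by blast
  have "poly_eval x (\<Sum>u\<leftarrow>us. pencil_form m L u u) = (\<Sum>u\<leftarrow>us. poly_eval x (pencil_form m L u u))"
    by (induction us) (simp_all add: linear_0[OF linear_poly_eval] linear_add[OF linear_poly_eval])
  also have "\<dots> \<ge> 0"
    using assms(2) unfolding spectrahedron_iff[OF assms(1)] by (intro sum_list_nonneg) auto
  finally show ?thesis using mtrace_mult_rank_one_sum[OF L S us] by simp
qed

section \<open>Truncated ideals of linear polynomials\<close>

text \<open>
  The part of the ideal generated by \<open>V\<close> that can be written with coefficients of degree at most 2. For
  linear \<open>V\<close> these are the polynomials \<open>X\<^sub>2\<^sup>* W X\<^sub>1\<close> in which the entries of \<open>W X\<^sub>1\<close> lie in \<open>V\<close>.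
\<close>

definition trunc_ideal :: "nat \<Rightarrow> rpoly set \<Rightarrow> rpoly set"
  where "trunc_ideal n V = span {q * v |q v. q \<in> polys_deg_le n 2 \<and> v \<in> V}"

lemma subspace_trunc_ideal: "subspace (trunc_ideal n V)"
  unfolding trunc_ideal_def by (rule subspace_span)

lemma mult_in_trunc_ideal: "q \<in> polys_deg_le n 2 \<Longrightarrow> v \<in> V \<Longrightarrow> q * v \<in> trunc_ideal n V"
  unfolding trunc_ideal_def by (intro span_base CollectI exI[of _ q] exI[of _ v] conjI refl)

lemma subset_trunc_ideal: "V \<subseteq> trunc_ideal n V"
proof
  fix v assume "v \<in> V"
  then show "v \<in> trunc_ideal n V"
    using mult_in_trunc_ideal[OF one_in_polys_deg_le, of v V n] by simp
qed

lemma row_poly_add: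
  assumes "A \<in> carrier_mat k (num_mons n e)" "B \<in> carrier_mat k (num_mons n e)" "r < k"
  shows "row_poly n e (A + B) r = row_poly n e A r + row_poly n e B r"
  unfolding row_poly_def sum.distrib[symmetric]
  by (rule sum.cong) (use assms in \<open>auto simp: scaleR_left_distrib\<close>)

lemma row_poly_smult:
  assumes "A \<in> carrier_mat k (num_mons n e)" "r < k"
  shows "row_poly n e (c \<cdot>\<^sub>m A) r = c *\<^sub>R row_poly n e A r"
  unfolding row_poly_def scaleR_sum_right
  by (rule sum.cong) (use assms in auto)

text \<open>
  The polynomials \<open>X\<^sub>2\<^sup>* W X\<^sub>1\<close> with all entries of \<open>W X\<^sub>1\<close> in \<open>V\<close> form a subspace, and \<open>q * v\<close> is among
  them: take for \<open>W\<close> the product of the coefficient vectors of \<open>q\<close> and \<open>v\<close>.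
\<close>

lemma trunc_ideal_gram:
  assumes V: "subspace V" "V \<subseteq> polys_deg_le n 1" and g: "g \<in> trunc_ideal n V"
  shows "\<exists>W\<in>carrier_mat (num_mons n 2) (num_mons n 1). gram_poly n 2 1 W = g \<and>
    (\<forall>r<num_mons n 2. row_poly n 1 W r \<in> V)"
proof -
  let ?C = "carrier_mat (num_mons n 2) (num_mons n 1) :: real mat set"
  define G where "G = {g. \<exists>W\<in>?C. gram_poly n 2 1 W = g \<and> (\<forall>r<num_mons n 2. row_poly n 1 W r \<in> V)}"
  have "subspace G"
  proof (rule subspaceI)
    have "row_poly n 1 (0\<^sub>m (num_mons n 2) (num_mons n 1)) r = 0" if "r < num_mons n 2" for r
      using that by (simp add: row_poly_def)
    then show "0 \<in> G" unfolding G_def using V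
      by (intro CollectI bexI[of _ "0\<^sub>m (num_mons n 2) (num_mons n 1)"]) (simp_all add: gram_poly_eq subspace_0)
  next
    fix f g assume "f \<in> G" "g \<in> G"
    then obtain A B where AB: "A \<in> ?C" "gram_poly n 2 1 A = f" "\<forall>r<num_mons n 2. row_poly n 1 A r \<in> V"
      "B \<in> ?C" "gram_poly n 2 1 B = g" "\<forall>r<num_mons n 2. row_poly n 1 B r \<in> V"
      by (auto simp: G_def)
    have AB': "A + B \<in> ?C" using AB by simp
    have "gram_poly n 2 1 (A + B) = f + g"
      unfolding gram_poly_eq[OF AB'] AB(2,5)[symmetric] gram_poly_eq[OF AB(1)] gram_poly_eq[OF AB(4)]
        sum.distrib[symmetric]
      by (intro sum.cong refl) (simp add: row_poly_add[OF AB(1,4)] distrib_left del: One_nat_def)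
    then show "f + g \<in> G" unfolding G_def using AB' AB(3,6) V(1)
      by (intro CollectI bexI[of _ "A + B"]) (auto simp: row_poly_add[OF AB(1,4)] subspace_add simp del: One_nat_def)
  next
    fix c g assume "g \<in> G"
    then obtain A where A: "A \<in> ?C" "gram_poly n 2 1 A = g" "\<forall>r<num_mons n 2. row_poly n 1 A r \<in> V"
      by (auto simp: G_def)
    have A': "c \<cdot>\<^sub>m A \<in> ?C" using A by simp
    have "gram_poly n 2 1 (c \<cdot>\<^sub>m A) = c *\<^sub>R g"
      unfolding gram_poly_eq[OF A'] A(2)[symmetric] gram_poly_eq[OF A(1)] scaleR_sum_right
      by (intro sum.cong refl) (simp add: row_poly_smult[OF A(1)] del: One_nat_def)
    then show "c *\<^sub>R g \<in> G" unfolding G_def using A' A(3) V(1)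
      by (intro CollectI bexI[of _ "c \<cdot>\<^sub>m A"]) (auto simp: row_poly_smult[OF A(1)] subspace_scale simp del: One_nat_def)
  qed
  moreover have "q * v \<in> G" if q: "q \<in> polys_deg_le n 2" and v: "v \<in> V" for q v
  proof -
    define a where "a = (\<lambda>r. Poly_Mapping.lookup q (monomial_list n 2 ! r))"
    define b where "b = (\<lambda>k. Poly_Mapping.lookup v (monomial_list n 1 ! k))"
    define W where "W = mat (num_mons n 2) (num_mons n 1) (\<lambda>(r, k). a r * b k)"
    have W: "W \<in> ?C" by (simp add: W_def)
    have v': "v = (\<Sum>k<num_mons n 1. b k *\<^sub>R nth_mono n 1 k)"
      using poly_expansion_nth_mono[of v n 1] v V(2) by (auto simp: b_def)
    have q': "q = (\<Sum>r<num_mons n 2. a r *\<^sub>R nth_mono n 2 r)"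
      using poly_expansion_nth_mono[OF q] by (simp add: a_def)
    have row: "row_poly n 1 W r = a r *\<^sub>R v" if "r < num_mons n 2" for r
      using that by (subst v') (simp add: row_poly_def W_def scaleR_sum_right)
    have "gram_poly n 2 1 W = (\<Sum>r<num_mons n 2. nth_mono n 2 r * (a r *\<^sub>R v))"
      unfolding gram_poly_eq[OF W] by (rule sum.cong) (simp_all add: row del: One_nat_def)
    also have "\<dots> = q * v" by (subst q') (simp add: sum_distrib_right)
    finally have "gram_poly n 2 1 W = q * v" .
    moreover have "row_poly n 1 W r \<in> V" if "r < num_mons n 2" for r
      unfolding row[OF that] using V(1) v by (rule subspace_scale)
    ultimately show ?thesis unfolding G_def using W by blast
  qed
  ultimately have "trunc_ideal n V \<subseteq> G" unfolding trunc_ideal_def by (intro span_minimal) auto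
  then show ?thesis using g by (auto simp: G_def)
qed

section \<open>Subspaces closed under sums of squares\<close>

(* Degree bounds are stated with the numeral 1; rewriting it to Suc 0 would hide them from the rules. *)
declare One_nat_def [simp del]

text \<open>
  A degree-bounded real radicality relative to the pencil: a linear polynomial whose square is the negative
  of \<open>tr(L S)\<close> modulo the truncated ideal vanishes on the zeros of \<open>V\<close> in the spectrahedron, and is
  required to be in \<open>V\<close>.
\<close>

definition sos_closed :: "nat \<Rightarrow> nat \<Rightarrow> rpoly mat \<Rightarrow> rpoly set \<Rightarrow> bool"
  where "sos_closed n m L V \<longleftrightarrow> (\<forall>l ps. l \<in> polys_deg_le n 1 \<longrightarrow>
    (\<forall>p\<in>set ps. \<forall>i. p i \<in> polys_deg_le n 1) \<longrightarrow>
    l * l + (\<Sum>p\<leftarrow>ps. pquad m L p) \<in> trunc_ideal n V \<longrightarrow> l \<in> V)"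

lemma sos_closedD:
  assumes "sos_closed n m L V" "l \<in> polys_deg_le n 1"
    and "\<And>p i. p \<in> set ps \<Longrightarrow> p i \<in> polys_deg_le n 1"
    and "l * l + (\<Sum>p\<leftarrow>ps. pquad m L p) \<in> trunc_ideal n V"
  shows "l \<in> V"
  using assms unfolding sos_closed_def by blast

lemma mult_Const_in_polys_deg_le:
  assumes "p \<in> polys_deg_le n 1"
  shows "p * Const r \<in> polys_deg_le n 1"
  using polys_deg_le_mult[OF assms Const_in_polys_deg_le[of r n 0]] by simp

lemma square_in_polys_deg_le:
  assumes "p \<in> polys_deg_le n 1"
  shows "p * p \<in> polys_deg_le n 2"
  using polys_deg_le_mult[OF assms assms] by (simp add: numeral_2_eq_2)

lemma sum_list_pquad_scaled:
  assumes "sym_mat m L"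
  shows "(\<Sum>p\<leftarrow>map (\<lambda>u i. q * Const (u i)) us. pquad m L p) = q * q * (\<Sum>u\<leftarrow>us. pencil_form m L u u)"
  by (induction us) (simp_all add: pquad_scaled_vector[OF assms] distrib_left)

text \<open>
  Otherwise \<open>1\<^sup>2 + tr(L S) \<in> V\<close> for the constant matrix \<open>S\<close> that is the sum of all \<open>u u\<^sup>* / c\<close>, which
  puts 1 into \<open>V\<close>.
\<close>

lemma sos_closed_no_constant:
  assumes L: "linear_pencil n m L" and V: "subspace V" "1 \<notin> V"
    and closed: "sos_closed n m L V" and "0 \<le> c"
    and mem: "Const c + (\<Sum>u\<leftarrow>us. pencil_form m L u u) \<in> V"
  shows "c = 0"
proof (rule ccontr)
  assume "c \<noteq> 0"
  then have "c > 0" using \<open>0 \<le> c\<close> by simp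
  have sym: "sym_mat m L" using L by (simp add: linear_pencil_def)
  define q where "q = Const (sqrt (1 / c))"
  have qq: "q * q = Const (1 / c)"
    using \<open>c > 0\<close> unfolding q_def Const_eq_of_real of_real_mult[symmetric] by simp
  have "Const (1 / c) * (Const c + (\<Sum>u\<leftarrow>us. pencil_form m L u u)) \<in> V"
    using subspace_scale[OF V(1) mem, of "1 / c"] by (simp only: Const_eq_of_real scaleR_conv_of_real)
  moreover have "Const (1 / c) * Const c = 1"
    using \<open>c > 0\<close> by (simp add: Const_eq_of_real flip: of_real_mult)
  ultimately have "1 * 1 + (\<Sum>p\<leftarrow>map (\<lambda>u i. q * Const (u i)) us. pquad m L p) \<in> V"
    unfolding sum_list_pquad_scaled[OF sym] qq by (simp add: distrib_left)
  then have "1 * 1 + (\<Sum>p\<leftarrow>map (\<lambda>u i. q * Const (u i)) us. pquad m L p) \<in> trunc_ideal n V"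
    using subset_trunc_ideal by blast
  then have "1 \<in> V"
    by (rule sos_closedD[OF closed one_in_polys_deg_le, rotated])
      (auto simp: q_def intro!: mult_Const_in_polys_deg_le Const_in_polys_deg_le)
  then show False using V(2) by simp
qed

text \<open>
  Let \<open>l = u\<^sup>* L u\<close> and \<open>q = (l + 1) / 2\<close>, so that \<open>(q - 1)\<^sup>2 = q\<^sup>2 - l\<close>. Weighting \<open>u\<close> with \<open>(q - 1)\<^sup>2\<close> and all the
  other vectors with \<open>q\<^sup>2\<close> gives the polynomial \<open>q\<^sup>2\<close> times the whole sum, minus \<open>l\<^sup>2\<close>. The
  first summand is in the truncated ideal.
\<close>

lemma sos_closed_face:
  assumes L: "linear_pencil n m L"
    and closed: "sos_closed n m L V"
    and mem: "(\<Sum>u\<leftarrow>us. pencil_form m L u u) \<in> V" and u: "u \<in> set us"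
  shows "pencil_form m L u u \<in> V"
proof -
  have sym: "sym_mat m L" using L by (simp add: linear_pencil_def)
  obtain xs ys where us: "us = xs @ u # ys" using u by (meson split_list)
  define l where "l = pencil_form m L u u"
  have l: "l \<in> polys_deg_le n 1" unfolding l_def by (rule pencil_form_in_polys_deg_le[OF L])
  define q where "q = (1 / 2) *\<^sub>R (l + 1)"
  define q' where "q' = q - 1"
  have q: "q \<in> polys_deg_le n 1" unfolding q_def
    by (intro subspace_scale subspace_add subspace_polys_deg_le l one_in_polys_deg_le)
  have q': "q' \<in> polys_deg_le n 1" unfolding q'_def
    by (intro subspace_diff subspace_polys_deg_le q one_in_polys_deg_le)
  have "q + q = l + 1" unfolding q_def scaleR_left_distrib[symmetric] by simp
  then have qq: "q' * q' = q * q - l" by (simp add: q'_def algebra_simps)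
  define ps where "ps = map (\<lambda>u i. q' * Const (u i)) [u] @ map (\<lambda>u i. q * Const (u i)) (xs @ ys)"
  have "(\<Sum>p\<leftarrow>ps. pquad m L p) = q' * q' * l + q * q * (\<Sum>u\<leftarrow>xs @ ys. pencil_form m L u u)"
    unfolding ps_def map_append sum_list_append sum_list_pquad_scaled[OF sym]
    by (simp add: l_def sum_list_pquad_scaled[OF sym] pquad_scaled_vector[OF sym] distrib_left)
  also have "\<dots> = q * q * (\<Sum>u\<leftarrow>us. pencil_form m L u u) - l * l"
    unfolding qq us by (simp add: l_def algebra_simps)
  finally have "l * l + (\<Sum>p\<leftarrow>ps. pquad m L p) = q * q * (\<Sum>u\<leftarrow>us. pencil_form m L u u)"
    by simp
  also have "\<dots> \<in> trunc_ideal n V"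
    by (intro mult_in_trunc_ideal square_in_polys_deg_le q mem)
  finally have "l \<in> V"
    by (rule sos_closedD[OF closed l, rotated])
      (auto simp: ps_def intro!: mult_Const_in_polys_deg_le q q')
  then show ?thesis by (simp add: l_def)
qed

text \<open>
  Let \<open>l = w\<^sup>* L u\<close> and \<open>b = w\<^sup>* L w\<close>. For \<open>p = q u + l w\<close> one has \<open>p\<^sup>* L p = q\<^sup>2 (u\<^sup>* L u) + l\<^sup>2 (2 q + b)\<close>. Choosing
  \<open>q = - (1 + b) / 2\<close> turns the second summand into \<open>- l\<^sup>2\<close>.
\<close>

lemma sos_closed_kernel:
  assumes L: "linear_pencil n m L"
    and closed: "sos_closed n m L V"
    and mem: "pencil_form m L u u \<in> V"
  shows "pencil_form m L w u \<in> V"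
proof -
  have sym: "sym_mat m L" using L by (simp add: linear_pencil_def)
  define l where "l = pencil_form m L u w"
  define b where "b = pencil_form m L w w"
  have lb: "l \<in> polys_deg_le n 1" "b \<in> polys_deg_le n 1"
    unfolding l_def b_def by (rule pencil_form_in_polys_deg_le[OF L])+
  define q where "q = (- 1 / 2) *\<^sub>R (1 + b)"
  have q: "q \<in> polys_deg_le n 1" unfolding q_def
    by (intro subspace_scale subspace_add subspace_polys_deg_le lb one_in_polys_deg_le)
  have "q + q = - (1 + b)" unfolding q_def scaleR_left_distrib[symmetric] by simp
  then have qq: "2 * q = - (1 + b)" by simp
  define p where "p = (\<lambda>i. q * Const (u i) + l * Const (w i))"
  have "pquad m L p = q * q * pencil_form m L u u + 2 * q * l * l + l * l * b"
    unfolding p_def pquad_constant_directions[OF sym] l_def b_def by simp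
  then have "l * l + (\<Sum>p\<leftarrow>[p]. pquad m L p) = q * q * pencil_form m L u u"
    unfolding qq by (simp add: algebra_simps)
  also have "\<dots> \<in> trunc_ideal n V"
    by (intro mult_in_trunc_ideal square_in_polys_deg_le q mem)
  finally have "l \<in> V"
    by (rule sos_closedD[OF closed lb(1), rotated])
      (auto simp: p_def intro!: subspace_add[OF subspace_polys_deg_le] mult_Const_in_polys_deg_le q lb)
  then show ?thesis unfolding l_def using pencil_form_commute[OF sym, of u w] by simp
qed

text \<open>
  The duality alternative is applied to the pencil bordered by a diagonal entry 1, whose quadratic values
  are \<open>u\<^sup>* L u + t\<^sup>2\<close>. A functional that is nonnegative on them is nonnegative at 1. Applied to \<open>- 1\<close>,
  the alternative yields one that is positive at 1; adding a large multiple of a functional that is negative at \<open>f\<close> allows the value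
  at 1 to be normalised even if the latter functional is zero there, that is, a direction at infinity.
\<close>

lemma sos_closed_separation:
  assumes L: "linear_pencil n m L" and V: "subspace V" "1 \<notin> V"
    and closed: "sos_closed n m L V"
  shows "(\<exists>us c. 0 \<le> c \<and> f - Const c - (\<Sum>u\<leftarrow>us. pencil_form m L u u) \<in> V) \<or>
    (\<exists>h :: rpoly \<Rightarrow> real. linear h \<and> h 1 = 1 \<and> (\<forall>u. 0 \<le> h (pencil_form m L u u)) \<and> h f < 0)"
proof -
  have sym: "sym_mat m L" using L by (simp add: linear_pencil_def)
  define B :: "nat \<Rightarrow> nat \<Rightarrow> rpoly" where
    "B = (\<lambda>i j. if i < m \<and> j < m then L $$ (i, j) else if i = m \<and> j = m then 1 else 0)"
  have bil_B: "bil {..m} B u w = pencil_form m L u w + Const (u m * w m)" for u w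
  proof -
    have "bil {..m} B u w = (\<Sum>i<m. \<Sum>j<m. (u i * w j) *\<^sub>R B i j) + (\<Sum>i<m. (u i * w m) *\<^sub>R B i m)
        + ((\<Sum>j<m. (u m * w j) *\<^sub>R B m j) + (u m * w m) *\<^sub>R B m m)"
      unfolding bil_def lessThan_Suc_atMost[symmetric] by (simp add: sum.distrib)
    moreover have "(\<Sum>i<m. (u i * w m) *\<^sub>R B i m) = 0" "(\<Sum>j<m. (u m * w j) *\<^sub>R B m j) = 0"
      by (auto simp: B_def)
    moreover have "(\<Sum>i<m. \<Sum>j<m. (u i * w j) *\<^sub>R B i j) = pencil_form m L u w"
      unfolding bil_def by (auto simp: B_def intro!: sum.cong)
    moreover have "(u m * w m) *\<^sub>R B m m = Const (u m * w m)"
      by (simp add: B_def Const_eq_of_real of_real_def)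
    ultimately show ?thesis by simp
  qed
  have sum_B: "(\<Sum>u\<leftarrow>us. bil {..m} B u u) = Const (\<Sum>u\<leftarrow>us. u m * u m) + (\<Sum>u\<leftarrow>us. pencil_form m L u u)" for us
    by (induction us) (simp_all add: bil_B Const_eq_of_real)
  have nonneg: "0 \<le> (\<Sum>u\<leftarrow>us. u m * u m)" for us :: "(nat \<Rightarrow> real) list"
    by (rule sum_list_nonneg) auto
  have alternative: "(\<exists>us. f - (\<Sum>u\<leftarrow>us. bil {..m} B u u) \<in> V) \<or>
    (\<exists>h :: rpoly \<Rightarrow> real. linear h \<and> (\<forall>v\<in>V. h v = 0) \<and> (\<forall>u. 0 \<le> h (bil {..m} B u u)) \<and> h f < 0)" for f
  proof (rule quadratic_values_alternative[OF _ _ V(1)])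
    show "B i j = B j i" for i j
      using sym_mat_index[OF sym, of i j] by (simp add: B_def)
    have square: "u m = 0 \<and> pencil_form m L u u \<in> V"
      if mem: "(\<Sum>u\<leftarrow>us. bil {..m} B u u) \<in> V" and u: "u \<in> set us" for us u
    proof -
      have *: "(\<Sum>u\<leftarrow>us. u m * u m) = 0"
        using sos_closed_no_constant[OF L V closed nonneg mem[unfolded sum_B]] .
      then have "(\<Sum>u\<leftarrow>us. pencil_form m L u u) \<in> V"
        using mem unfolding sum_B by (simp add: Const_eq_of_real)
      then have "pencil_form m L u u \<in> V" using u by (rule sos_closed_face[OF L closed])
      moreover have "u m * u m = 0"
        using * u by (subst (asm) sum_list_nonneg_eq_0_iff) auto
      ultimately show ?thesis by simp
    qed
    show "bil {..m} B u u \<in> V" if "(\<Sum>u\<leftarrow>us. bil {..m} B u u) \<in> V" "u \<in> set us" for us u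
      using square[OF that] unfolding bil_B by (simp add: Const_eq_of_real)
    show "bil {..m} B w u \<in> V" if "bil {..m} B u u \<in> V" for u w
      using square[of "[u]" u] that sos_closed_kernel[OF L closed, of u w]
      unfolding bil_B by (simp add: Const_eq_of_real)
  qed simp
  have "\<not> (\<exists>us. - 1 - (\<Sum>u\<leftarrow>us. bil {..m} B u u) \<in> V)"
  proof
    assume "\<exists>us. - 1 - (\<Sum>u\<leftarrow>us. bil {..m} B u u) \<in> V"
    then obtain us where "- 1 - (\<Sum>u\<leftarrow>us. bil {..m} B u u) \<in> V" by blast
    then have "- (- 1 - (\<Sum>u\<leftarrow>us. bil {..m} B u u)) \<in> V" by (rule subspace_neg[OF V(1)])
    then have "Const (1 + (\<Sum>u\<leftarrow>us. u m * u m)) + (\<Sum>u\<leftarrow>us. pencil_form m L u u) \<in> V"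
      unfolding sum_B by (simp add: Const_eq_of_real add_ac)
    then have "1 + (\<Sum>u\<leftarrow>us. u m * u m) = 0"
      by (intro sos_closed_no_constant[OF L V closed]) (use nonneg[of us] in auto)
    then show False using nonneg[of us] by simp
  qed
  then obtain h0 :: "rpoly \<Rightarrow> real" where h0: "linear h0" "\<And>u. 0 \<le> h0 (bil {..m} B u u)" "h0 (- 1) < 0"
    using alternative[of "- 1"] by blast
  have h_form: "0 \<le> h (pencil_form m L u u)" if "\<And>u. 0 \<le> h (bil {..m} B u u)" for h :: "rpoly \<Rightarrow> real" and u
  proof -
    have "bil {..m} B (u(m := 0)) (u(m := 0)) = pencil_form m L u u"
      unfolding bil_B by (simp add: Const_eq_of_real) (rule bil_cong, auto)
    then show ?thesis using that by metis
  qed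
  have h_one: "0 \<le> h 1" if "\<And>u. 0 \<le> h (bil {..m} B u u)" for h :: "rpoly \<Rightarrow> real"
  proof -
    have "bil {..m} B (\<lambda>i. if i = m then 1 else 0) (\<lambda>i. if i = m then 1 else 0) = 1"
      unfolding bil_B by (simp add: Const_eq_of_real) (simp add: bil_def)
    then show ?thesis using that by metis
  qed
  from alternative[of f] show ?thesis
  proof (elim disjE exE conjE)
    fix us assume *: "f - (\<Sum>u\<leftarrow>us. bil {..m} B u u) \<in> V"
    show ?thesis
      by (intro disjI1 exI[of _ us] exI[of _ "\<Sum>u\<leftarrow>us. u m * u m"] conjI nonneg)
        (use * in \<open>simp add: sum_B diff_diff_eq\<close>)
  next
    fix h :: "rpoly \<Rightarrow> real"
    assume h: "linear h" "\<forall>u. 0 \<le> h (bil {..m} B u u)" "h f < 0"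
    \<comment> \<open>Large enough for h to outweigh h0 at f, while h0 keeps the value at 1 positive.\<close>
    define t where "t = (\<bar>h0 f\<bar> + 1) / - h f"
    have t: "0 \<le> t" "t * h f = - (\<bar>h0 f\<bar> + 1)" using h(3) by (auto simp: t_def field_simps)
    define g where "g = (\<lambda>p. h0 p + t * h p)"
    have g: "linear g" unfolding g_def
      by (rule linearI) (simp_all add: linear_add[OF h0(1)] linear_add[OF h(1)]
          linear_scale[OF h0(1)] linear_scale[OF h(1)] algebra_simps)
    have "0 < h0 1" using h0(3) linear_neg[OF h0(1), of 1] by simp
    moreover have "0 \<le> t * h 1" using t h_one[of h] h(2) by simp
    ultimately have g1: "0 < g 1" unfolding g_def by linarith
    have gf: "g f < 0" unfolding g_def t(2) by linarith
    have g_form: "0 \<le> g (pencil_form m L u u)" for u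
      unfolding g_def using h_form[of h0 u] h_form[of h u] h0(2) h(2) t(1) by simp
    show ?thesis
    proof (intro disjI2 exI[of _ "\<lambda>p. (1 / g 1) * g p"] conjI allI)
      show "linear (\<lambda>p. (1 / g 1) * g p)"
        by (rule linearI) (simp_all add: linear_add[OF g] linear_scale[OF g] add_divide_distrib)
      show "(1 / g 1) * g 1 = 1" "(1 / g 1) * g f < 0" using g1 gf by (simp_all add: divide_neg_pos)
      show "0 \<le> (1 / g 1) * g (pencil_form m L u u)" for u using g_form g1 by simp
    qed
  qed
qed

text \<open>
  By dimension, \<open>B\<close> and 1 span all linear polynomials, so modulo the span of \<open>B\<close> every linear \<open>q\<close> is the
  constant \<open>h q\<close>. If \<open>h f\<close> is negative, either some \<open>u\<^sup>* L u\<close> has a negative value and \<open>f\<close> is congruent to a positive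
  multiple of it, or \<open>h\<close> itself separates.
\<close>

lemma hyperplane_separation:
  assumes L: "linear_pencil n m L" and f: "f \<in> polys_deg_le n 1"
    and B: "B \<subseteq> polys_deg_le n 1" "independent B" "finite B" "card B = n" "1 \<notin> span B"
  shows "(\<exists>us c. 0 \<le> c \<and> f - Const c - (\<Sum>u\<leftarrow>us. pencil_form m L u u) \<in> span B) \<or>
    (\<exists>h :: rpoly \<Rightarrow> real. linear h \<and> h 1 = 1 \<and> (\<forall>u. 0 \<le> h (pencil_form m L u u)) \<and> h f < 0)"
proof -
  have 1: "1 \<notin> B" using B(5) span_base by blast
  have indep: "independent (insert 1 B)" using B(2,5) by (simp add: independent_insert)
  then obtain h :: "rpoly \<Rightarrow> real" where h: "linear h"
    and h_val: "\<And>x. x \<in> insert 1 B \<Longrightarrow> h x = (if x = 1 then 1 else 0)"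
    using linear_independent_extend[of "insert 1 B" "\<lambda>x. if x = 1 then 1 else (0::real)"] by blast
  have h1: "h 1 = 1" using h_val[of 1] by simp
  have hB: "h v = 0" if "v \<in> span B" for v
    by (rule linear_eq_0_on_span[OF h _ that]) (use h_val 1 in auto)
  have spanning: "polys_deg_le n 1 \<subseteq> span (insert 1 B)"
  proof (rule ccontr)
    assume "\<not> ?thesis"
    then obtain q where q: "q \<in> polys_deg_le n 1" "q \<notin> span (insert 1 B)" by blast
    then have "independent (insert q (insert 1 B))" using indep by (simp add: independent_insert)
    moreover have "insert q (insert 1 B) \<subseteq> span (as_poly ` mons_le n 1)"
    proof -
      have "p \<in> span (as_poly ` mons_le n 1)" if "p \<in> polys_deg_le n 1" for p
        using that by (intro poly_in_span_mono) (simp add: polys_deg_le_iff)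
      then show ?thesis using q(1) B(1) one_in_polys_deg_le[of n 1] by blast
    qed
    moreover have fin: "finite (as_poly ` mons_le n 1)" unfolding mons_le_1 by simp
    ultimately have "card (insert q (insert 1 B)) \<le> card (as_poly ` mons_le n 1)"
      using independent_span_bound by blast
    also have "\<dots> \<le> n + 1"
    proof -
      have "card (as_poly ` mons_le n 1) \<le> card (mons_le n 1)"
        unfolding mons_le_1 by (intro card_image_le) simp
      also have "\<dots> \<le> Suc (card ((\<lambda>i. Poly_Mapping.single i (1::nat)) ` {..<n}))"
        unfolding mons_le_1 by (rule card_insert_le_m1) simp_all
      also have "\<dots> \<le> n + 1" using card_image_le[of "{..<n}" "\<lambda>i. Poly_Mapping.single i (1::nat)"] by simp
      finally show ?thesis .
    qed
    also have "card (insert q (insert 1 B)) = n + 2"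
      using q(2) 1 B(3,4) span_base[of q "insert 1 B"] by (subst card_insert_disjoint) auto
    finally show False by simp
  qed
  have congruent: "q - Const (h q) \<in> span B" if "q \<in> polys_deg_le n 1" for q
  proof -
    have "q \<in> span (insert 1 B)" using that spanning by blast
    then obtain k where k: "q - k *\<^sub>R 1 \<in> span B" unfolding span_breakdown_eq ..
    then have "h q = k" using hB[OF k] h1 by (simp add: linear_diff[OF h] linear_scale[OF h])
    then show ?thesis using k by (simp add: Const_eq_of_real of_real_def)
  qed
  show ?thesis
  proof (cases "0 \<le> h f")
    case True
    then show ?thesis
      by (intro disjI1 exI[of _ "[]"] exI[of _ "h f"]) (use congruent[OF f] in simp)
  next
    case False
    show ?thesis
    proof (cases "\<forall>u. 0 \<le> h (pencil_form m L u u)")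
      case True
      then show ?thesis using False h h1 by (intro disjI2 exI[of _ h]) auto
    next
      case negative: False
      then obtain u where u: "h (pencil_form m L u u) < 0" by (auto simp: not_le)
      define t where "t = h f / h (pencil_form m L u u)"
      have t: "0 \<le> t" "t * h (pencil_form m L u u) = h f"
        using u False by (auto simp: t_def divide_nonpos_neg)
      define q where "q = f - t *\<^sub>R pencil_form m L u u"
      have "q \<in> polys_deg_le n 1" unfolding q_def
        by (intro subspace_diff subspace_scale subspace_polys_deg_le f pencil_form_in_polys_deg_le[OF L])
      moreover have "h q = 0" using t by (simp add: q_def linear_diff[OF h] linear_scale[OF h])
      ultimately have "q \<in> span B" using congruent[of q] by (simp add: Const_eq_of_real)
      moreover have "pencil_form m L (\<lambda>i. sqrt t * u i) (\<lambda>i. sqrt t * u i) = t *\<^sub>R pencil_form m L u u"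
        using t(1) by (simp add: bil_scale_left bil_scale_right)
      ultimately show ?thesis
        by (intro disjI1 exI[of _ "[\<lambda>i. sqrt t * u i]"] exI[of _ 0]) (simp add: q_def Const_eq_of_real)
    qed
  qed
qed

section \<open>Chains of certificates\<close>

lemma gram_transpose_mult:
  assumes W: "W \<in> carrier_mat s (num_mons n e)"
  shows "gram_poly n e e (transpose_mat W * W) = (\<Sum>r<s. row_poly n e W r * row_poly n e W r)"
proof -
  let ?N = "num_mons n e"
  have carrier: "transpose_mat W * W \<in> carrier_mat ?N ?N" using W by simp
  have row: "row_poly n e (transpose_mat W * W) k = (\<Sum>r<s. W $$ (r, k) *\<^sub>R row_poly n e W r)"
    if "k < ?N" for k
  proof -
    have "row_poly n e (transpose_mat W * W) k =
        (\<Sum>l<?N. (\<Sum>r<s. W $$ (r, k) * W $$ (r, l)) *\<^sub>R nth_mono n e l)"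
      unfolding row_poly_def using W that
      by (auto simp: scalar_prod_def atLeast0LessThan intro!: sum.cong)
    also have "\<dots> = (\<Sum>l<?N. \<Sum>r<s. W $$ (r, k) *\<^sub>R W $$ (r, l) *\<^sub>R nth_mono n e l)"
      by (simp add: scaleR_sum_left)
    also have "\<dots> = (\<Sum>r<s. W $$ (r, k) *\<^sub>R row_poly n e W r)"
      unfolding row_poly_def scaleR_sum_right by (rule sum.swap)
    finally show ?thesis .
  qed
  have "gram_poly n e e (transpose_mat W * W) =
      (\<Sum>k<?N. \<Sum>r<s. (W $$ (r, k) *\<^sub>R nth_mono n e k) * row_poly n e W r)"
    unfolding gram_poly_eq[OF carrier] by (rule sum.cong) (simp_all add: row sum_distrib_left)
  also have "\<dots> = (\<Sum>r<s. \<Sum>k<?N. (W $$ (r, k) *\<^sub>R nth_mono n e k) * row_poly n e W r)"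
    by (rule sum.swap)
  also have "\<dots> = (\<Sum>r<s. row_poly n e W r * row_poly n e W r)"
    by (simp add: row_poly_def[of n e W] sum_distrib_right)
  finally show ?thesis .
qed

lemma gram_poly_diff:
  assumes A: "A \<in> carrier_mat (num_mons n d) (num_mons n e)"
    and B: "B \<in> carrier_mat (num_mons n d) (num_mons n e)"
  shows "gram_poly n d e (A - B) = gram_poly n d e A - gram_poly n d e B"
proof -
  have AB: "A - B \<in> carrier_mat (num_mons n d) (num_mons n e)" by (rule minus_carrier_mat[OF B])
  have "row_poly n e (A - B) r = row_poly n e A r - row_poly n e B r" if "r < num_mons n d" for r
    unfolding row_poly_def sum_subtractf[symmetric]
    by (rule sum.cong) (use A B that in \<open>auto simp: scaleR_left_diff_distrib\<close>)
  then show ?thesis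
    unfolding gram_poly_eq[OF A] gram_poly_eq[OF B] gram_poly_eq[OF AB] sum_subtractf[symmetric]
    by (intro sum.cong refl) (simp add: right_diff_distrib)
qed

lemma poly_eval_gram_psd_nonneg:
  assumes "psd_mat (num_mons n e) A"
  shows "0 \<le> poly_eval x (gram_poly n e e A)"
proof -
  have A: "A \<in> carrier_mat (num_mons n e) (num_mons n e)"
    using assms by (simp add: psd_mat_def sym_mat_def)
  define u where "u = (\<lambda>k. poly_eval x (nth_mono n e k))"
  have "poly_eval x (gram_poly n e e A) = bil {..<num_mons n e} (\<lambda>i j. A $$ (i, j)) u u"
    unfolding gram_poly_eq[OF A] row_poly_def bil_def u_def
    by (simp add: linear_sum[OF linear_poly_eval] linear_scale[OF linear_poly_eval] poly_eval_mult
        sum_distrib_left mult_ac)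
  then show ?thesis using assms by (simp add: psd_mat_iff_bil)
qed

text \<open>
  One stage of the certificate, where \<open>W'\<close> is the matrix of the preceding stage.
\<close>

definition certificate_stage ::
    "nat \<Rightarrow> nat \<Rightarrow> rpoly mat \<Rightarrow> rpoly mat \<Rightarrow> real mat \<Rightarrow> real mat \<Rightarrow> real mat \<Rightarrow> bool"
  where "certificate_stage n m L Sq U W' W \<longleftrightarrow>
    quadratic_sos_mat n m Sq \<and> sym_mat (num_mons n 1) U \<and>
    W \<in> carrier_mat (num_mons n 2) (num_mons n 1) \<and>
    gram_poly n 1 1 U + gram_poly n 2 1 W' + mtrace (L * Sq) = 0 \<and>
    psd_mat (num_mons n 1) (U - transpose_mat W * W)"

text \<open>
  The values at \<open>x\<close> satisfy \<open>|W X\<^sub>1|\<^sup>2 \<le> X\<^sub>1\<^sup>* U X\<^sub>1 = - tr(L Sq) \<le> 0\<close>, so all entries of \<open>W X\<^sub>1\<close> vanish.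
\<close>

lemma certificate_stage_vanishing:
  assumes L: "linear_pencil n m L" and x: "x \<in> spectrahedron n m L"
    and stage: "certificate_stage n m L Sq U W' W"
    and W': "poly_eval x (gram_poly n 2 1 W') = 0"
  shows "poly_eval x (gram_poly n 2 1 W) = 0"
proof -
  note ev = linear_add[OF linear_poly_eval] linear_diff[OF linear_poly_eval]
    linear_sum[OF linear_poly_eval] linear_0[OF linear_poly_eval]
  have W: "W \<in> carrier_mat (num_mons n 2) (num_mons n 1)"
    and eq: "gram_poly n 1 1 U + gram_poly n 2 1 W' + mtrace (L * Sq) = 0"
    using stage by (simp_all add: certificate_stage_def)
  have U: "U \<in> carrier_mat (num_mons n 1) (num_mons n 1)"
    using stage by (simp add: certificate_stage_def sym_mat_def)
  have WW: "transpose_mat W * W \<in> carrier_mat (num_mons n 1) (num_mons n 1)" using W by simp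
  define w where "w = (\<lambda>r. poly_eval x (row_poly n 1 W r))"
  have "0 \<le> poly_eval x (mtrace (L * Sq))"
    using stage by (intro poly_eval_mtrace_sos_nonneg[OF L x])
      (simp add: certificate_stage_def quadratic_sos_mat_def)
  moreover have "poly_eval x (gram_poly n 1 1 U) + poly_eval x (mtrace (L * Sq)) = 0"
    using arg_cong[OF eq, of "poly_eval x"] W' by (simp add: ev)
  moreover have "0 \<le> poly_eval x (gram_poly n 1 1 (U - transpose_mat W * W))"
    using stage by (intro poly_eval_gram_psd_nonneg) (simp add: certificate_stage_def)
  moreover have "poly_eval x (gram_poly n 1 1 (transpose_mat W * W)) = (\<Sum>r<num_mons n 2. (w r)\<^sup>2)"
    unfolding gram_transpose_mult[OF W] by (simp add: ev poly_eval_mult w_def power2_eq_square)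
  ultimately have "(\<Sum>r<num_mons n 2. (w r)\<^sup>2) \<le> 0"
    unfolding gram_poly_diff[OF U WW] ev by linarith
  then have "(\<Sum>r<num_mons n 2. (w r)\<^sup>2) = 0" by (intro antisym sum_nonneg) auto
  then have "w r = 0" if "r < num_mons n 2" for r
    using that by (simp add: sum_nonneg_eq_0_iff)
  then show ?thesis
    unfolding gram_poly_eq[OF W] by (simp add: ev poly_eval_mult w_def)
qed

text \<open>
  Every element of the truncated ideal, not just one, is required to be the end of a chain of \<open>k\<close> stages:
  the next stage decides which element it needs.
\<close>

definition certified_ideal :: "nat \<Rightarrow> nat \<Rightarrow> rpoly mat \<Rightarrow> nat \<Rightarrow> rpoly set \<Rightarrow> bool"
  where "certified_ideal n m L k V \<longleftrightarrow> (\<forall>g\<in>trunc_ideal n V. \<exists>Sq U W.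
    W 0 = 0\<^sub>m (num_mons n 2) (num_mons n 1) \<and>
    (\<forall>i\<in>{1..k}. certificate_stage n m L (Sq i) (U i) (W (i - 1)) (W i)) \<and>
    gram_poly n 2 1 (W k) = g)"

lemma certified_ideal_zero: "certified_ideal n m L 0 (span {})"
  unfolding certified_ideal_def
proof
  fix g assume "g \<in> trunc_ideal n (span {})"
  also have "trunc_ideal n (span {}) \<subseteq> {0}"
    unfolding trunc_ideal_def by (intro span_minimal) auto
  finally have "g = 0" by simp
  have "gram_poly n 2 1 (0\<^sub>m (num_mons n 2) (num_mons n 1)) = 0"
    by (simp add: gram_poly_eq row_poly_def)
  then show "\<exists>Sq U W. W 0 = 0\<^sub>m (num_mons n 2) (num_mons n 1) \<and>
      (\<forall>i\<in>{1..0::nat}. certificate_stage n m L (Sq i) (U i) (W (i - 1)) (W i)) \<and> gram_poly n 2 1 (W 0) = g"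
    unfolding \<open>g = 0\<close> by (intro exI[of _ "\<lambda>_. 0\<^sub>m (num_mons n 2) (num_mons n 1)"] conjI) auto
qed

text \<open>
  Write the prescribed polynomial as \<open>X\<^sub>2\<^sup>* W X\<^sub>1\<close> with entries \<open>v\<^sub>r + c\<^sub>r l\<close> of \<open>W X\<^sub>1\<close>, where \<open>v\<^sub>r\<close> is in the
  span of \<open>B\<close>, and take \<open>U = W\<^sup>* W\<close>. Its polynomial is the sum of the squares of the entries, thus
  \<open>a l\<^sup>2\<close> modulo the truncated ideal of the span, with \<open>a\<close> the sum of the \<open>c\<^sub>r\<^sup>2\<close>. Multiplying the relation
  for \<open>l\<close> by \<open>a\<close> shows that \<open>X\<^sub>1\<^sup>* U X\<^sub>1 + tr(L S)\<close> is in this truncated ideal, so by hypothesis the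
  chain of \<open>k\<close> stages can be chosen to cancel it.
\<close>

lemma certified_ideal_Suc:
  assumes L: "linear_pencil n m L" and B: "B \<subseteq> polys_deg_le n 1"
    and cert: "certified_ideal n m L k (span B)"
    and l: "l \<in> polys_deg_le n 1" and ps: "\<And>p i. p \<in> set ps \<Longrightarrow> p i \<in> polys_deg_le n 1"
    and mem: "l * l + (\<Sum>p\<leftarrow>ps. pquad m L p) \<in> trunc_ideal n (span B)"
  shows "certified_ideal n m L (Suc k) (span (insert l B))"
  unfolding certified_ideal_def
proof
  let ?I = "trunc_ideal n (span B)" and ?s1 = "num_mons n 1" and ?s2 = "num_mons n 2"
  have Lc: "L \<in> carrier_mat m m" using L by (simp add: linear_pencil_def sym_mat_def)
  have span_B: "span B \<subseteq> polys_deg_le n 1" by (rule span_minimal[OF B subspace_polys_deg_le])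
  fix g assume "g \<in> trunc_ideal n (span (insert l B))"
  moreover have "span (insert l B) \<subseteq> polys_deg_le n 1"
    using B l by (intro span_minimal subspace_polys_deg_le) auto
  ultimately obtain W where W: "W \<in> carrier_mat ?s2 ?s1" "gram_poly n 2 1 W = g"
    "\<And>r. r < ?s2 \<Longrightarrow> row_poly n 1 W r \<in> span (insert l B)"
    using trunc_ideal_gram[OF subspace_span, of "insert l B" n g] by blast
  have "\<exists>c. row_poly n 1 W r - c *\<^sub>R l \<in> span B" if "r < ?s2" for r
    using W(3)[OF that] by (simp add: span_breakdown_eq)
  then obtain c where c: "\<And>r. r < ?s2 \<Longrightarrow> row_poly n 1 W r - c r *\<^sub>R l \<in> span B" by metis
  define a where "a = (\<Sum>r<?s2. c r * c r)"
  have a: "0 \<le> a" unfolding a_def by (intro sum_nonneg) simp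
  define U where "U = transpose_mat W * W"
  have U_gram: "gram_poly n 1 1 U - a *\<^sub>R (l * l) \<in> ?I"
  proof -
    have "row_poly n 1 W r * row_poly n 1 W r - (c r * c r) *\<^sub>R (l * l) \<in> ?I" if "r < ?s2" for r
    proof -
      define v where "v = row_poly n 1 W r - c r *\<^sub>R l"
      have v: "v \<in> span B" using c[OF that] by (simp add: v_def)
      have "row_poly n 1 W r * row_poly n 1 W r - (c r * c r) *\<^sub>R (l * l) = (v + (2 * c r) *\<^sub>R l) * v"
      proof -
        have "row_poly n 1 W r = v + c r *\<^sub>R l" by (simp add: v_def)
        then show ?thesis by (simp add: algebra_simps scaleR_2 flip: scaleR_scaleR)
      qed
      also have "\<dots> \<in> ?I"
      proof (rule mult_in_trunc_ideal[OF _ v])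
        have "v + (2 * c r) *\<^sub>R l \<in> polys_deg_le n 1"
          using span_B v l by (intro subspace_add subspace_scale subspace_polys_deg_le) auto
        then show "v + (2 * c r) *\<^sub>R l \<in> polys_deg_le n 2" by (rule polys_deg_le_mono) simp
      qed
      finally show ?thesis .
    qed
    then have "(\<Sum>r<?s2. row_poly n 1 W r * row_poly n 1 W r - (c r * c r) *\<^sub>R (l * l)) \<in> ?I"
      by (intro subspace_sum[OF subspace_trunc_ideal]) simp
    then show ?thesis
      unfolding U_def gram_transpose_mult[OF W(1)] a_def by (simp add: sum_subtractf scaleR_sum_left)
  qed
  define ps' where "ps' = map (\<lambda>p i. sqrt a *\<^sub>R p i) ps"
  have "p i \<in> polys_deg_le n 1" if "p \<in> set ps'" for p i
    using that ps by (auto simp: ps'_def intro!: subspace_scale[OF subspace_polys_deg_le])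
  then obtain S where S: "quadratic_sos_mat n m S" "mtrace (L * S) = (\<Sum>p\<leftarrow>ps'. pquad m L p)"
    using quadratic_sos_of_list[OF Lc, of ps' n] by blast
  have S_eq: "mtrace (L * S) = a *\<^sub>R (\<Sum>p\<leftarrow>ps. pquad m L p)"
    unfolding S(2) ps'_def using a by (induction ps) (simp_all add: pquad_scale scaleR_add_right)
  define g' where "g' = - (gram_poly n 1 1 U + mtrace (L * S))"
  have "(gram_poly n 1 1 U - a *\<^sub>R (l * l)) + a *\<^sub>R (l * l + (\<Sum>p\<leftarrow>ps. pquad m L p)) \<in> ?I"
    by (intro subspace_add[OF subspace_trunc_ideal] subspace_scale[OF subspace_trunc_ideal] U_gram mem)
  then have "gram_poly n 1 1 U + mtrace (L * S) \<in> ?I"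
    unfolding S_eq by (simp add: scaleR_add_right)
  then have "g' \<in> ?I" unfolding g'_def by (rule subspace_neg[OF subspace_trunc_ideal])
  then obtain Sq Us Ws where IH: "Ws 0 = 0\<^sub>m ?s2 ?s1"
    "\<And>i. i \<in> {1..k} \<Longrightarrow> certificate_stage n m L (Sq i) (Us i) (Ws (i - 1)) (Ws i)"
    "gram_poly n 2 1 (Ws k) = g'"
    using cert unfolding certified_ideal_def by blast
  have U: "sym_mat ?s1 U"
    unfolding sym_mat_def U_def using W(1) by (simp add: transpose_mult[of _ ?s1 ?s2 _ ?s1])
  have "U - transpose_mat W * W = 0\<^sub>m ?s1 ?s1"
    unfolding U_def using W(1) by (intro minus_r_inv_mat) simp
  moreover have "psd_mat ?s1 (0\<^sub>m ?s1 ?s1)"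
    by (simp add: psd_mat_iff_bil sym_mat_def bil_def)
  ultimately have stage: "certificate_stage n m L S U (Ws k) W"
    unfolding certificate_stage_def using S(1) U W(1) by (simp add: IH(3) g'_def)
  show "\<exists>Sq U W. W 0 = 0\<^sub>m ?s2 ?s1 \<and>
      (\<forall>i\<in>{1..Suc k}. certificate_stage n m L (Sq i) (U i) (W (i - 1)) (W i)) \<and>
      gram_poly n 2 1 (W (Suc k)) = g"
  proof (intro exI conjI ballI)
    show "(Ws(Suc k := W)) 0 = 0\<^sub>m ?s2 ?s1" using IH(1) by simp
    show "gram_poly n 2 1 ((Ws(Suc k := W)) (Suc k)) = g" using W(2) by simp
    fix i assume "i \<in> {1..Suc k}"
    then consider "i \<in> {1..k}" | "i = Suc k" by force
    then show "certificate_stage n m L ((Sq(Suc k := S)) i) ((Us(Suc k := U)) i)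
        ((Ws(Suc k := W)) (i - 1)) ((Ws(Suc k := W)) i)"
    proof cases
      case 1
      then have "i \<noteq> Suc k" "i - 1 \<noteq> Suc k" by auto
      then show ?thesis using IH(2)[OF 1] by simp
    next
      case 2
      then show ?thesis using stage by simp
    qed
  qed
qed

text \<open>
  As long as the subspace is not closed, a stage adds an independent polynomial. Once it is closed, further
  stages are spent on \<open>l = 0\<close>, which leaves the subspace unchanged.
\<close>

lemma certified_ideal_exists:
  assumes L: "linear_pencil n m L"
  shows "\<exists>B. B \<subseteq> polys_deg_le n 1 \<and> independent B \<and> finite B \<and> certified_ideal n m L k (span B) \<and>
    (card B = k \<or> sos_closed n m L (span B))"
proof (induction k)
  case 0
  show ?case
    by (rule exI[of _ "{}"]) (use certified_ideal_zero in \<open>simp add: independent_empty\<close>)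
next
  case (Suc k)
  then obtain B where B: "B \<subseteq> polys_deg_le n 1" "independent B" "finite B"
    "certified_ideal n m L k (span B)" "card B = k \<or> sos_closed n m L (span B)" by blast
  show ?case
  proof (cases "sos_closed n m L (span B)")
    case True
    \<comment> \<open>The stage for l = 0 with the empty sum of squares.\<close>
    have "certified_ideal n m L (Suc k) (span (insert 0 B))"
      by (rule certified_ideal_Suc[OF L B(1,4), of 0 "[]"])
        (auto simp: subspace_0[OF subspace_polys_deg_le] subspace_0[OF subspace_trunc_ideal])
    then show ?thesis using B True by (intro exI[of _ B]) (simp add: span_insert_0)
  next
    case False
    then obtain l ps where l: "l \<in> polys_deg_le n 1" "\<And>p i. p \<in> set ps \<Longrightarrow> p i \<in> polys_deg_le n 1"
      "l * l + (\<Sum>p\<leftarrow>ps. pquad m L p) \<in> trunc_ideal n (span B)" "l \<notin> span B"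
      unfolding sos_closed_def by blast
    have "certified_ideal n m L (Suc k) (span (insert l B))"
      by (rule certified_ideal_Suc[OF L B(1,4) l(1) _ l(3)]) (rule l(2))
    moreover have "independent (insert l B)" using B(2) l(4) by (simp add: independent_insert)
    moreover have "card (insert l B) = Suc k"
      using B False l(4) span_base[of l B] by (subst card_insert_disjoint) auto
    ultimately show ?thesis using B l(1) by (intro exI[of _ "insert l B"]) simp
  qed
qed

text \<open>
  If 1 is in the span, the truncated ideal contains \<open>f\<close>. Otherwise failure would give a separating
  functional, which is evaluation at a point of the spectrahedron where \<open>f\<close> is negative.
\<close>

lemma nonneg_on_spectrahedron_certificate:
  assumes L: "linear_pencil n m L" and f: "f \<in> polys_deg_le n 1"
    and nonneg: "\<And>x. x \<in> spectrahedron n m L \<Longrightarrow> 0 \<le> poly_eval x f"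
    and B: "B \<subseteq> polys_deg_le n 1" "independent B" "finite B"
    and "card B = n \<or> sos_closed n m L (span B)"
  shows "\<exists>us c. 0 \<le> c \<and> f - Const c - (\<Sum>u\<leftarrow>us. pencil_form m L u u) \<in> trunc_ideal n (span B)"
proof (cases "1 \<in> span B")
  case True
  have "f * 1 \<in> trunc_ideal n (span B)"
    using f True by (intro mult_in_trunc_ideal polys_deg_le_mono[where k = 1 and l = 2]) auto
  then show ?thesis
    by (intro exI[of _ "[]"] exI[of _ 0]) (simp add: Const_eq_of_real)
next
  case False
  have "(\<exists>us c. 0 \<le> c \<and> f - Const c - (\<Sum>u\<leftarrow>us. pencil_form m L u u) \<in> span B) \<or>
    (\<exists>h :: rpoly \<Rightarrow> real. linear h \<and> h 1 = 1 \<and> (\<forall>u. 0 \<le> h (pencil_form m L u u)) \<and> h f < 0)"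
    using assms(7)
  proof
    assume "card B = n"
    then show ?thesis using hyperplane_separation[OF L f B _ False] by blast
  next
    assume "sos_closed n m L (span B)"
    then show ?thesis by (rule sos_closed_separation[OF L subspace_span False])
  qed
  moreover have "\<not> (\<exists>h :: rpoly \<Rightarrow> real. linear h \<and> h 1 = 1 \<and> (\<forall>u. 0 \<le> h (pencil_form m L u u)) \<and> h f < 0)"
  proof (intro notI, elim exE conjE)
    fix h :: "rpoly \<Rightarrow> real"
    assume h: "linear h" "h 1 = 1" "\<forall>u. 0 \<le> h (pencil_form m L u u)" "h f < 0"
    define x where "x = vec n (\<lambda>i. h (as_poly (Poly_Mapping.single i 1)))"
    have eval: "h p = poly_eval x p" if "p \<in> polys_deg_le n 1" for p
      unfolding x_def by (rule linear_functional_eq_poly_eval[OF h(1,2) that])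
    have "x \<in> spectrahedron n m L"
      using h(3) eval[OF pencil_form_in_polys_deg_le[OF L]]
      unfolding spectrahedron_iff[OF L] by (simp add: x_def)
    then have "0 \<le> h f" using nonneg eval[OF f] by simp
    then show False using h(4) by simp
  qed
  ultimately show ?thesis using subset_trunc_ideal by blast
qed

theorem theorem3p5p2:
  fixes n m :: nat and L :: "rpoly mat" and f :: rpoly
  assumes "linear_pencil n m L"
    and "f \<in> polys_deg_le n 1"
  shows "(\<forall>x\<in>spectrahedron n m L. 0 \<le> poly_eval x f) \<longleftrightarrow>
    (\<exists>(Sq :: nat \<Rightarrow> rpoly mat) (U :: nat \<Rightarrow> real mat) (W :: nat \<Rightarrow> real mat) (S :: real mat) (c :: real).
       (\<forall>i\<in>{1..n}. quadratic_sos_mat n m (Sq i)) \<and>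
       (\<forall>i\<in>{1..n}. sym_mat (num_mons n 1) (U i)) \<and>
       (\<forall>i\<in>{1..n}. W i \<in> carrier_mat (num_mons n 2) (num_mons n 1)) \<and>
       psd_mat m S \<and>
       0 \<le> c \<and>
       W 0 = 0\<^sub>m (num_mons n 2) (num_mons n 1) \<and>
       (\<forall>i\<in>{1..n}.
          gram_poly n 1 1 (U i) + gram_poly n 2 1 (W (i - 1)) + mtrace (L * Sq i) = 0) \<and>
       (\<forall>i\<in>{1..n}. psd_mat (num_mons n 1) (U i - transpose_mat (W i) * W i)) \<and>
       f - Const c + gram_poly n 2 1 (W n) - mtrace (L * map_mat Const S) = 0)"
    (is "?nonneg \<longleftrightarrow> ?certificate")
proof
  assume ?nonneg
  obtain B where B: "B \<subseteq> polys_deg_le n 1" "independent B" "finite B"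
    "certified_ideal n m L n (span B)" "card B = n \<or> sos_closed n m L (span B)"
    using certified_ideal_exists[OF assms(1), of n] by blast
  obtain us c where c: "0 \<le> c" "f - Const c - (\<Sum>u\<leftarrow>us. pencil_form m L u u) \<in> trunc_ideal n (span B)"
    using nonneg_on_spectrahedron_certificate[OF assms _ B(1-3,5)] \<open>?nonneg\<close> by blast
  have "L \<in> carrier_mat m m" using assms(1) by (simp add: linear_pencil_def sym_mat_def)
  then obtain S where S: "psd_mat m S" "mtrace (L * map_mat Const S) = (\<Sum>u\<leftarrow>us. pencil_form m L u u)"
    using psd_mat_of_list by blast
  have "- (f - Const c - mtrace (L * map_mat Const S)) \<in> trunc_ideal n (span B)"
    unfolding S(2) by (rule subspace_neg[OF subspace_trunc_ideal c(2)])
  then obtain Sq U W where W: "W 0 = 0\<^sub>m (num_mons n 2) (num_mons n 1)"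
    "\<And>i. i \<in> {1..n} \<Longrightarrow> certificate_stage n m L (Sq i) (U i) (W (i - 1)) (W i)"
    "gram_poly n 2 1 (W n) = - (f - Const c - mtrace (L * map_mat Const S))"
    using B(4) unfolding certified_ideal_def by blast
  show ?certificate
    using W(1,2) S(1) c(1) unfolding certificate_stage_def
    by (intro exI[of _ Sq] exI[of _ U] exI[of _ W] exI[of _ S] exI[of _ c]) (simp add: W(3))
next
  assume ?certificate
  then obtain Sq U W S c where stage: "\<And>i. i \<in> {1..n} \<Longrightarrow> certificate_stage n m L (Sq i) (U i) (W (i - 1)) (W i)"
    and S: "psd_mat m S" "0 \<le> c" and W0: "W 0 = 0\<^sub>m (num_mons n 2) (num_mons n 1)"
    and final: "f - Const c + gram_poly n 2 1 (W n) - mtrace (L * map_mat Const S) = 0"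
    unfolding certificate_stage_def by metis
  show ?nonneg
  proof
    fix x assume x: "x \<in> spectrahedron n m L"
    have "poly_eval x (gram_poly n 2 1 (W k)) = 0" if "k \<le> n" for k
      using that
    proof (induction k)
      case 0
      show ?case by (simp add: W0 gram_poly_eq row_poly_def linear_0[OF linear_poly_eval])
    next
      case (Suc k)
      then have "certificate_stage n m L (Sq (Suc k)) (U (Suc k)) (W k) (W (Suc k))"
        using stage[of "Suc k"] by simp
      then show ?case
        by (rule certificate_stage_vanishing[OF assms(1) x]) (use Suc in simp)
    qed
    moreover have "0 \<le> poly_eval x (mtrace (L * map_mat Const S))"
      by (rule poly_eval_mtrace_psd_nonneg[OF assms(1) x S(1)])
    moreover have "f = Const c - gram_poly n 2 1 (W n) + mtrace (L * map_mat Const S)"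
      using final by (simp add: algebra_simps)
    ultimately show "0 \<le> poly_eval x f"
      using S(2) by (simp add: linear_add[OF linear_poly_eval] linear_diff[OF linear_poly_eval] poly_eval_Const)
  qed
qed

end
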